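(* Let $X$, $\Gamma$, $m$, $C(m)$, $(Z,d)$, $f$ and $\lambda=\min\{\lambda_u : u\in\Sigma(0)\}$ be as defined in the context. If $\lambda > \dfrac{C(m)}{2}$, then $\Gamma$ has a fixed point for every $\rho:\Gamma\to\mathrm{Isom}(Z)$, i.e. there is $z\in Z$ with $\rho(\gamma).z=z$ for all $\gamma\in\Gamma$.
   Context: **Complex and group.** $X$ is a simplicial complex of dimension $n\ge 2$ such that all the links of $X$ are connected and the links of all the vertices of $X$ are finite. $\Gamma$ is a locally compact, properly discontinuous, unimodular group of automorphisms of $X$ acting cocompactly on $X$. $\Sigma(k)$ is the set of ordered $k$-simplices of $X$ (ordered $(k+1)$-tuples of vertices spanning a $k$-simplex). $\rho:\Gamma\to\mathrm{Isom}(Z)$ denotes a homomorphism to the group of isometries of $Z$, i.e. an action of $\Gamma$ on $Z$ by isometries. **Weight.** $m:\Sigma(1)\cup\Sigma(2)\to(0,\infty)$ is a fixed weight on $X$: it is $\Gamma$-invariant, invariant under permuting the entries of a tuple, and there is a constant $C(m)$ such that for every $\tau\in\Sigma(1)$ $$\sum_{\sigma\in\Sigma(2),\,\tau\subset\sigma} m(\sigma)=3!\,C(m)\,m(\tau),$$ where $\tau\subset\sigma$ means that all the vertices of $\tau$ are contained in $\sigma$, with no regard to the ordering. **Links.** For a vertex $u$, $X_u$ is the link of $u$: the subcomplex of dimension $n-1$ consisting of the simplices $(w_0,\dots,w_k)$ such that $u\notin\{w_0,\dots,w_k\}$ and $(u,w_0,\dots,w_k)\in\Sigma(k+1)$. $\Sigma_u(k)$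 is the set of ordered $k$-simplices of $X_u$. For $\eta=(v,w)\in\Sigma_u(1)$ put $m_u(\eta)=m((u,v,w))$. **The space $Z$.** $(Z,d)$ is either (a) a complete, uniquely geodesic metric space (any two points are joined by a unique geodesic) which is uniformly convex and non positively curved in the sense of Busemann, or (b) a reflexive Banach space with $d$ the metric induced by the norm. In case (a), $\frac12x+\frac12y$ denotes the midpoint of the unique geodesic from $x$ to $y$. "Uniformly convex" means that there is a map $\theta:(0,\infty)\times(0,2]\to(0,1]$ such that for all $r>0$, $\varepsilon\in(0,2]$ and $a,x,y\in Z$, the inequalities $d(a,x)\le r$, $d(a,y)\le r$, $d(x,y)\ge\varepsilon r$ imply $d(\frac12x+\frac12y,a)\le(1-\theta(r,\varepsilon))r$, and $\inf_{r>0}\theta(r,\varepsilon)>0$ for every $\varepsilon\in(0,2]$. "Non positively curved in the sense of Busemann" means $d(\frac12x+\frac12z,\frac12y+\frac12z)\le\frac12d(x,y)$ for all $x,y,z\in Z$. **The function $f$.** $f:[0,\infty)\to[0,\infty)$ is a fixed function with $f(0)=0$, strictly monotone increasing, strictly convex, and such that for all constants $0\le\kappa<1$ and $C\ge0$, $\sum_{k=1}^\infty f^{-1}(C\kappa^k)<\infty$. **The constants $\lambda_u$.** For a vertex $u$ let $C^0(X_u)=\{\phi:\Sigma_u(0)\to Z\}$. For $\phi\in C^0(X_u)$ put $$E_{u,\phi}(\xi)=\sum_{v\in\Sigma_u(0)}m((u,v))\,f(d(\xi,\phi(v)))\quad(\xi\in Z),\qquad d_u\phi((v,w))=d(\phi(v),\phi(w))\quad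 ((v,w)\in\Sigma_u(1)).$$ $M_u\phi\in Z$ is the unique minimum point of $E_{u,\phi}$; its existence and uniqueness are derived from the strict convexity of $f$, the convexity of each $d(\cdot,\phi(v))$, and the fact that $E_{u,\phi}(\xi)\to\infty$ as $\xi$ goes to infinity. Then $$\lambda_u=\sup\Big\{\lambda:\ \lambda\,E_{u,\phi}(M_u\phi)\le\sum_{\eta\in\Sigma_u(1)}\frac{m_u(\eta)}2\,f(d_u\phi(\eta))\ \text{ for all }\phi\in C^0(X_u)\Big\}.$$
   Formalization: The action ρ is assumed continuous (orbit maps γ ↦ ρ(γ).z are continuous; vacuous for discrete Γ), as the claim fails for discontinuous ρ of non-discrete Γ; "all the links connected" is read to include X itself being connected. *)

theory Defs
  imports "HOL-Analysis.Analysis" "HOL-Algebra.Group_Action"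
begin

section \<open>Simplicial complexes\<close>

text \<open>A complex is given by its set of nonempty simplices; its vertex set is \<open>\<Union>X\<close>.\<close>

definition simplicial_cplx :: "'v set set \<Rightarrow> bool" where
  "simplicial_cplx X \<longleftrightarrow>
     (\<forall>\<sigma>\<in>X. finite \<sigma> \<and> \<sigma> \<noteq> {}) \<and> (\<forall>\<sigma>\<in>X. \<forall>\<tau>. \<tau> \<subseteq> \<sigma> \<longrightarrow> \<tau> \<noteq> {} \<longrightarrow> \<tau> \<in> X)"

definition cplx_dim :: "'v set set \<Rightarrow> nat \<Rightarrow> bool" where
  "cplx_dim X n \<longleftrightarrow> (\<forall>\<sigma>\<in>X. card \<sigma> \<le> n + 1) \<and> (\<exists>\<sigma>\<in>X. card \<sigma> = n + 1)"

definition ordered_simplices :: "'v set set \<Rightarrow> nat \<Rightarrow> 'v list set" where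
  "ordered_simplices X k = {xs. length xs = k + 1 \<and> distinct xs \<and> set xs \<in> X}"

definition cplx_link :: "'v set set \<Rightarrow> 'v set \<Rightarrow> 'v set set" where
  "cplx_link X \<sigma> = {\<tau>. \<tau> \<noteq> {} \<and> \<tau> \<inter> \<sigma> = {} \<and> \<sigma> \<union> \<tau> \<in> X}"

definition cplx_connected :: "'v set set \<Rightarrow> bool" where
  "cplx_connected X \<longleftrightarrow> (\<forall>u\<in>\<Union>X. \<forall>v\<in>\<Union>X. (u, v) \<in> {(x, y). {x, y} \<in> X}\<^sup>*)"

text \<open>
  As usual, the empty simplex is allowed here, so that \<open>X = cplx_link X {}\<close> itself is
  connected, and zero-dimensional links are exempt: the link of a codimension one simplex is
  a discrete set of points, in general more than one.
\<close>

definition links_connected :: "'v set set \<Rightarrow> bool" where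
  "links_connected X \<longleftrightarrow>
     (\<forall>\<sigma>\<in>insert {} X. (\<exists>\<tau>\<in>cplx_link X \<sigma>. card \<tau> \<ge> 2) \<longrightarrow> cplx_connected (cplx_link X \<sigma>))"

definition vertex_links_finite :: "'v set set \<Rightarrow> bool" where
  "vertex_links_finite X \<longleftrightarrow> (\<forall>u\<in>\<Union>X. finite (cplx_link X {u}))"

section \<open>Topological groups of automorphisms\<close>

definition topological_group :: "('g, 'e) monoid_scheme \<Rightarrow> 'g topology \<Rightarrow> bool" where
  "topological_group G T \<longleftrightarrow>
     group G \<and> topspace T = carrier G \<and> Hausdorff_space T \<and>
     continuous_map (prod_topology T T) T (\<lambda>(x, y). x \<otimes>\<^bsub>G\<^esub> y) \<and>
     continuous_map T T (\<lambda>x. inv\<^bsub>G\<^esub> x)"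

definition radon_measure :: "'g topology \<Rightarrow> 'g measure \<Rightarrow> bool" where
  "radon_measure T \<mu> \<longleftrightarrow>
     space \<mu> = topspace T \<and> sets \<mu> = sigma_sets (topspace T) {U. openin T U} \<and>
     (\<forall>K. compactin T K \<longrightarrow> K \<in> sets \<mu> \<longrightarrow> emeasure \<mu> K < \<infinity>) \<and>
     (\<forall>A\<in>sets \<mu>. emeasure \<mu> A = (INF U\<in>{U. openin T U \<and> A \<subseteq> U}. emeasure \<mu> U)) \<and>
     (\<forall>U. openin T U \<longrightarrow>
        emeasure \<mu> U = (SUP K\<in>{K. compactin T K \<and> K \<subseteq> U}. emeasure \<mu> K))"

definition left_haar_measure ::
    "('g, 'e) monoid_scheme \<Rightarrow> 'g topology \<Rightarrow> 'g measure \<Rightarrow> bool" where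
  "left_haar_measure G T \<mu> \<longleftrightarrow>
     radon_measure T \<mu> \<and> emeasure \<mu> (space \<mu>) \<noteq> 0 \<and>
     (\<forall>g\<in>carrier G. \<forall>A\<in>sets \<mu>. emeasure \<mu> (g <#\<^bsub>G\<^esub> A) = emeasure \<mu> A)"

text \<open>
  A left Haar measure is unique up to scaling, so it does not matter which one is tested.
\<close>

definition unimodular_group :: "('g, 'e) monoid_scheme \<Rightarrow> 'g topology \<Rightarrow> bool" where
  "unimodular_group G T \<longleftrightarrow>
     (\<exists>\<mu>. left_haar_measure G T \<mu> \<and>
          (\<forall>g\<in>carrier G. \<forall>A\<in>sets \<mu>. emeasure \<mu> (A #>\<^bsub>G\<^esub> g) = emeasure \<mu> A))"

text \<open>
  A group of automorphisms of \<open>X\<close>, as a group \<open>G\<close> with a faithful action \<open>\<alpha>\<close> on the vertices.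
  It preserves simplices in both directions, because \<open>G\<close> is closed under inverses.
\<close>

definition automorphism_group ::
    "'v set set \<Rightarrow> ('g, 'e) monoid_scheme \<Rightarrow> ('g \<Rightarrow> 'v \<Rightarrow> 'v) \<Rightarrow> bool" where
  "automorphism_group X G \<alpha> \<longleftrightarrow>
     faithful_action G (\<Union>X) \<alpha> \<and> (\<forall>g\<in>carrier G. \<forall>\<sigma>\<in>X. \<alpha> g ` \<sigma> \<in> X)"

text \<open>
  Proper discontinuity for a group with a topology: the transporters of vertices, hence the
  stabilisers of simplices, are open (the action is continuous) and compact. If the topology
  is discrete this says that they are finite.
\<close>

definition properly_discontinuous ::
    "'v set set \<Rightarrow> ('g, 'e) monoid_scheme \<Rightarrow> 'g topology \<Rightarrow> ('g \<Rightarrow> 'v \<Rightarrow> 'v) \<Rightarrow> bool" where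
  "properly_discontinuous X G T \<alpha> \<longleftrightarrow>
     (\<forall>u\<in>\<Union>X. \<forall>v\<in>\<Union>X. openin T {g\<in>carrier G. \<alpha> g u = v} \<and>
                       compactin T {g\<in>carrier G. \<alpha> g u = v})"

definition cocompact_action ::
    "'v set set \<Rightarrow> ('g, 'e) monoid_scheme \<Rightarrow> ('g \<Rightarrow> 'v \<Rightarrow> 'v) \<Rightarrow> bool" where
  "cocompact_action X G \<alpha> \<longleftrightarrow>
     (\<exists>F. finite F \<and> F \<subseteq> X \<and> (\<forall>\<sigma>\<in>X. \<exists>\<tau>\<in>F. \<exists>g\<in>carrier G. \<sigma> = \<alpha> g ` \<tau>))"

section \<open>Weights\<close>

definition weight ::
    "'v set set \<Rightarrow> ('g, 'e) monoid_scheme \<Rightarrow> ('g \<Rightarrow> 'v \<Rightarrow> 'v) \<Rightarrow> ('v list \<Rightarrow> real) \<Rightarrow> real \<Rightarrow> bool"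
  where
  "weight X G \<alpha> m C \<longleftrightarrow>
     (\<forall>\<sigma>\<in>ordered_simplices X 1 \<union> ordered_simplices X 2.
        m \<sigma> > 0 \<and> (\<forall>g\<in>carrier G. m (map (\<alpha> g) \<sigma>) = m \<sigma>) \<and>
        (\<forall>\<sigma>'. mset \<sigma>' = mset \<sigma> \<longrightarrow> m \<sigma>' = m \<sigma>)) \<and>
     (\<forall>\<tau>\<in>ordered_simplices X 1.
        (\<Sum>\<sigma> | \<sigma> \<in> ordered_simplices X 2 \<and> set \<tau> \<subseteq> set \<sigma>. m \<sigma>) = fact 3 * C * m \<tau>)"

section \<open>The metric spaces\<close>

definition geodesic :: "(real \<Rightarrow> 'z::metric_space) \<Rightarrow> 'z \<Rightarrow> 'z \<Rightarrow> bool" where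
  "geodesic c x y \<longleftrightarrow>
     c 0 = x \<and> c (dist x y) = y \<and>
     (\<forall>s\<in>{0..dist x y}. \<forall>t\<in>{0..dist x y}. dist (c s) (c t) = \<bar>s - t\<bar>)"

definition uniquely_geodesic :: "'z::metric_space itself \<Rightarrow> bool" where
  "uniquely_geodesic _ \<longleftrightarrow>
     (\<forall>x y::'z. (\<exists>c. geodesic c x y) \<and>
        (\<forall>c c'. geodesic c x y \<longrightarrow> geodesic c' x y \<longrightarrow> (\<forall>t\<in>{0..dist x y}. c t = c' t)))"

definition geodesic_midpoint :: "'z::metric_space \<Rightarrow> 'z \<Rightarrow> 'z" where
  "geodesic_midpoint x y = (THE z. \<exists>c. geodesic c x y \<and> z = c (dist x y / 2))"

definition metric_uniformly_convex :: "'z::metric_space itself \<Rightarrow> bool" where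
  "metric_uniformly_convex _ \<longleftrightarrow>
     (\<exists>\<theta>::real \<Rightarrow> real \<Rightarrow> real.
        (\<forall>r>0. \<forall>\<epsilon>\<in>{0<..2}. \<theta> r \<epsilon> \<in> {0<..1} \<and>
           (\<forall>a x y::'z. dist a x \<le> r \<longrightarrow> dist a y \<le> r \<longrightarrow> dist x y \<ge> \<epsilon> * r \<longrightarrow>
              dist (geodesic_midpoint x y) a \<le> (1 - \<theta> r \<epsilon>) * r)) \<and>
        (\<forall>\<epsilon>\<in>{0<..2}. (INF r\<in>{0<..}. \<theta> r \<epsilon>) > 0))"

definition busemann_nonpos_curved :: "'z::metric_space itself \<Rightarrow> bool" where
  "busemann_nonpos_curved _ \<longleftrightarrow>
     (\<forall>x y z::'z. dist (geodesic_midpoint x z) (geodesic_midpoint y z) \<le> dist x y / 2)"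

text \<open>Every element of the bidual is evaluation at a point.\<close>

definition reflexive_space :: "'b::real_normed_vector itself \<Rightarrow> bool" where
  "reflexive_space _ \<longleftrightarrow>
     (\<forall>F::('b \<Rightarrow>\<^sub>L real) \<Rightarrow>\<^sub>L real. \<exists>x::'b. \<forall>g. blinfun_apply F g = blinfun_apply g x)"

definition isom_group :: "('z::metric_space \<Rightarrow> 'z) monoid" where
  "isom_group = \<lparr>carrier = {h. bij h \<and> (\<forall>x y. dist (h x) (h y) = dist x y)},
                 monoid.mult = (\<circ>), one = id\<rparr>"

text \<open>
  The homomorphism is continuous for the topology of pointwise convergence on the isometry
  group, which is no condition if the group \<open>G\<close> is discrete.
\<close>

definition isometric_action ::
    "('g, 'e) monoid_scheme \<Rightarrow> 'g topology \<Rightarrow> ('g \<Rightarrow> 'z::metric_space \<Rightarrow> 'z) \<Rightarrow> bool" where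
  "isometric_action G T \<rho> \<longleftrightarrow>
     \<rho> \<in> hom G isom_group \<and> (\<forall>z. continuous_map T euclidean (\<lambda>g. \<rho> g z))"

section \<open>The gauge function\<close>

definition strictly_convex_on :: "real set \<Rightarrow> (real \<Rightarrow> real) \<Rightarrow> bool" where
  "strictly_convex_on S f \<longleftrightarrow> convex S \<and>
     (\<forall>x\<in>S. \<forall>y\<in>S. \<forall>t\<in>{0<..<1}. x \<noteq> y \<longrightarrow>
        f ((1 - t) * x + t * y) < (1 - t) * f x + t * f y)"

definition gauge_fun :: "(real \<Rightarrow> real) \<Rightarrow> bool" where
  "gauge_fun f \<longleftrightarrow>
     f \<in> {0..} \<rightarrow> {0..} \<and> f 0 = 0 \<and> strict_mono_on {0..} f \<and> strictly_convex_on {0..} f \<and>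
     (\<forall>\<kappa> K. 0 \<le> \<kappa> \<longrightarrow> \<kappa> < 1 \<longrightarrow> 0 \<le> K \<longrightarrow>
        summable (\<lambda>k. inv_into {0..} f (K * \<kappa> ^ Suc k)))"

section \<open>Local energies and the constants \<open>\<lambda>\<^sub>u\<close>\<close>

definition link_energy ::
    "'v set set \<Rightarrow> ('v list \<Rightarrow> real) \<Rightarrow> (real \<Rightarrow> real) \<Rightarrow> 'v \<Rightarrow> ('v \<Rightarrow> 'z::metric_space) \<Rightarrow> 'z \<Rightarrow> real"
  where
  "link_energy X m f u \<phi> \<xi> =
     (\<Sum>v | [v] \<in> ordered_simplices (cplx_link X {u}) 0. m [u, v] * f (dist \<xi> (\<phi> v)))"

text \<open>
  In a Banach space whose norm is not strictly convex there may be several minimum points.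
  Only the value of the energy at a minimum point is used, and it does not depend on the choice.
\<close>

definition link_center ::
    "'v set set \<Rightarrow> ('v list \<Rightarrow> real) \<Rightarrow> (real \<Rightarrow> real) \<Rightarrow> 'v \<Rightarrow> ('v \<Rightarrow> 'z::metric_space) \<Rightarrow> 'z"
  where
  "link_center X m f u \<phi> = arg_min (link_energy X m f u \<phi>) (\<lambda>_. True)"

definition link_edge_energy ::
    "'v set set \<Rightarrow> ('v list \<Rightarrow> real) \<Rightarrow> (real \<Rightarrow> real) \<Rightarrow> 'v \<Rightarrow> ('v \<Rightarrow> 'z::metric_space) \<Rightarrow> real"
  where
  "link_edge_energy X m f u \<phi> =
     (\<Sum>(v, w) | [v, w] \<in> ordered_simplices (cplx_link X {u}) 1.
        m [u, v, w] / 2 * f (dist (\<phi> v) (\<phi> w)))"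

text \<open>
  A supremum in the extended reals: it is \<open>\<infinity>\<close> if the space is a single point. Functions on the
  vertices of the link are represented by functions on the whole type, of which only the values
  on the link matter.
\<close>

definition link_lambda ::
    "'z::metric_space itself \<Rightarrow> 'v set set \<Rightarrow> ('v list \<Rightarrow> real) \<Rightarrow> (real \<Rightarrow> real) \<Rightarrow> 'v \<Rightarrow> ereal"
  where
  "link_lambda _ X m f u =
     Sup {ereal l | l. \<forall>\<phi>::'v \<Rightarrow> 'z.
            l * link_energy X m f u \<phi> (link_center X m f u \<phi>) \<le> link_edge_energy X m f u \<phi>}"

text \<open>
  The infimum is a minimum for a cocompact action: the constant only depends on the orbit of
  the vertex.
\<close>

definition min_link_lambda ::
    "'z::metric_space itself \<Rightarrow> 'v set set \<Rightarrow> ('v list \<Rightarrow> real) \<Rightarrow> (real \<Rightarrow> real) \<Rightarrow> ereal" where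
  "min_link_lambda Z X m f = (INF u\<in>\<Union>X. link_lambda Z X m f u)"

end

theory Submission
  imports Defs "HOL-Combinatorics.Multiset_Permutations"
begin

text \<open>
  The fixed point is found by making equivariant maps \<open>\<phi>\<close> from the vertices of \<open>X\<close> to the space
  more and more constant. The energy of such a map is the sum of \<open>m [u, v] * f (dist (\<phi> u) (\<phi> v))\<close>
  over the edges modulo the group, where a vertex orbit is weighted by the inverse of the Haar
  measure of a stabiliser. Because the group is unimodular, sums of this kind may be
  reorganised freely (\<open>mass_transport\<close>). In particular the energies of the links add up to
  \<open>C / 2\<close> times the energy of \<open>\<phi>\<close> (\<open>sum_link_edge_energy\<close>), while the mixed energy, which
  compares one map at one end of an edge with another map at the other end, is symmetric in the
  two maps (\<open>energy_commute\<close>).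

  Now replace \<open>\<phi> u\<close> by a centre \<open>\<psi> u\<close> of the values of \<open>\<phi>\<close> on the link of \<open>u\<close>. If all the constants
  of the links exceed \<open>l > C / 2\<close>, then the mixed energy of \<open>\<psi>\<close> and \<open>\<phi>\<close> is at most
  \<open>\<kappa> = C / (2 * l) < 1\<close> times the energy of \<open>\<phi>\<close>. The energy of \<open>\<psi>\<close> alone is not controlled, but
  the map that takes the midpoints of \<open>\<phi> u\<close> and \<open>\<psi> u\<close> has at most the mixed energy: the Busemann
  inequality bounds the distance of two such midpoints by the mean of the distances from \<open>\<phi> u\<close> to
  \<open>\<psi> v\<close> and from \<open>\<psi> u\<close> to \<open>\<phi> v\<close> (\<open>energy_decrease\<close>). Iterating this, the energy decays like
  \<open>\<kappa> ^ k\<close>. There are only finitely many edges modulo the group, so all displacements are bounded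
  by \<open>f\<close>-preimages of constant multiples of \<open>\<kappa> ^ k\<close>, which are summable by the choice of \<open>f\<close>.
  The limit map is constant along edges, hence constant as \<open>X\<close> is connected, and equivariant
  (\<open>fixed_point_of_spectral_gap\<close>).

  For \<open>\<psi>\<close> to be equivariant, its value at \<open>u\<close> has to be fixed by the stabiliser of \<open>u\<close>, a compact
  group. The energy of a link is an invariant convex function, and it suffices to find a fixed
  point in a sublevel set. In a uniformly convex space this is the Chebyshev centre of an orbit
  (\<open>uniformly_convex_fixed_point\<close>). In a Banach space isometries preserve midpoints by the
  Mazur-Ulam theorem (\<open>isometry_midpoint\<close>), and a compact group of isometries has a fixed point
  in every invariant closed convex set, because compact convex sets have normal structure
  (\<open>banach_compact_group_fixed_point\<close>). The same facts provide the first equivariant map.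
\<close>


section \<open>Gauge functions\<close>

lemma gauge_fun_strict_mono:
  assumes "gauge_fun f" "0 \<le> x" "x < y"
  shows "f x < f y"
proof -
  have "strict_mono_on {0..} f" using assms(1) by (simp add: gauge_fun_def)
  then show ?thesis using assms(2,3) by (intro strict_mono_onD[of "{0..}" f]) auto
qed

lemma gauge_fun_mono:
  assumes "gauge_fun f" "0 \<le> x" "x \<le> y"
  shows "f x \<le> f y"
  using gauge_fun_strict_mono[OF assms(1,2), of y] assms(3) by (cases "x = y") auto

lemma gauge_fun_zero: "gauge_fun f \<Longrightarrow> f 0 = 0"
  by (simp add: gauge_fun_def)

lemma gauge_fun_nonneg: "gauge_fun f \<Longrightarrow> 0 \<le> x \<Longrightarrow> 0 \<le> f x"
  using gauge_fun_mono[of f 0 x] gauge_fun_zero[of f] by simp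

lemma gauge_fun_convex:
  assumes "gauge_fun f" "0 \<le> x" "0 \<le> y" "0 \<le> t" "t \<le> 1"
  shows "f ((1 - t) * x + t * y) \<le> (1 - t) * f x + t * f y"
proof -
  consider "t = 0" | "t = 1" | "x = y" | "t \<in> {0<..<1}" "x \<noteq> y" using assms by fastforce
  then show ?thesis
  proof cases
    case 3
    have "(1 - t) * y + t * y = y" "(1 - t) * f y + t * f y = f y" by (simp_all add: algebra_simps)
    with 3 show ?thesis by simp
  next
    case 4
    have "strictly_convex_on {0..} f" using assms(1) by (simp add: gauge_fun_def)
    with 4 assms have "f ((1 - t) * x + t * y) < (1 - t) * f x + t * f y"
      unfolding strictly_convex_on_def by (metis atLeast_iff)
    then show ?thesis by simp
  qed auto
qed

lemma gauge_fun_midpoint: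
  assumes "gauge_fun f" "0 \<le> x" "0 \<le> y"
  shows "f ((x + y) / 2) \<le> (f x + f y) / 2"
  using gauge_fun_convex[OF assms, of "1/2"] by (simp add: field_simps)

text \<open>
  The even extension of a convex increasing function is convex on the whole line, hence
  continuous also at the end point \<open>0\<close>.
\<close>

lemma gauge_fun_continuous:
  assumes "gauge_fun f"
  shows "continuous_on UNIV (\<lambda>x::real. f \<bar>x\<bar>)"
proof (rule convex_on_continuous[OF open_UNIV], rule convex_onI)
  fix t x y :: real assume t: "t > 0" "t < 1"
  have "\<bar>(1 - t) * x + t * y\<bar> \<le> (1 - t) * \<bar>x\<bar> + t * \<bar>y\<bar>"
    using t abs_triangle_ineq[of "(1-t)*x" "t*y"] by (simp add: abs_mult)
  then have "f \<bar>(1 - t) * x + t * y\<bar> \<le> f ((1 - t) * \<bar>x\<bar> + t * \<bar>y\<bar>)"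
    by (rule gauge_fun_mono[OF assms, rotated]) simp
  also have "\<dots> \<le> (1 - t) * f \<bar>x\<bar> + t * f \<bar>y\<bar>"
    using t by (intro gauge_fun_convex[OF assms]) auto
  finally show "f \<bar>(1 - t) *\<^sub>R x + t *\<^sub>R y\<bar> \<le> (1 - t) * f \<bar>x\<bar> + t * f \<bar>y\<bar>" by simp
qed auto

lemma gauge_fun_surj:
  assumes f: "gauge_fun f" and y: "0 \<le> y"
  shows "y \<in> f ` {0..}"
proof -
  have f1: "f 1 > 0" and f0: "f 0 = 0"
    using gauge_fun_strict_mono[OF f, of 0 1] gauge_fun_zero[OF f] by simp_all
  define b where "b = max 1 (y / f 1)"
  have b: "b \<ge> 1" "y / f 1 \<le> b" by (simp_all add: b_def)
  then have yb: "y \<le> b * f 1" using f1 by (simp add: pos_divide_le_eq)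
  \<comment> \<open>Convexity between \<open>0\<close> and \<open>b\<close> bounds \<open>f b\<close> from below by a linear function.\<close>
  have "f 1 \<le> (1/b) * f b"
    using gauge_fun_convex[OF f, of 0 b "1/b"] b f0 by simp
  then have "b * f 1 \<le> f b" using b(1) mult_left_mono[of "f 1" "1 / b * f b" b] by simp
  then have "y \<le> f \<bar>b\<bar>" using yb b(1) by simp
  moreover have "continuous_on {0..b} (\<lambda>x. f \<bar>x\<bar>)"
    using gauge_fun_continuous[OF f] continuous_on_subset by blast
  moreover have "f \<bar>0\<bar> \<le> y" "0 \<le> b" using f0 y b by auto
  ultimately obtain x where x: "0 \<le> x" "f \<bar>x\<bar> = y"
    using IVT'[of "\<lambda>x. f \<bar>x\<bar>" 0 y b] by blast
  then show ?thesis by (intro image_eqI[of _ _ x]) simp_all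
qed

lemma gauge_fun_le_inv:
  assumes f: "gauge_fun f" and t: "0 \<le> t" "f t \<le> y"
  shows "t \<le> inv_into {0..} f y"
proof (rule ccontr)
  have y: "y \<in> f ` {0..}"
    using gauge_fun_surj[OF f] gauge_fun_nonneg[OF f t(1)] t(2) by auto
  assume "\<not> ?thesis"
  then have "f (inv_into {0..} f y) < f t"
    using inv_into_into[OF y] by (intro gauge_fun_strict_mono[OF f]) auto
  then show False using f_inv_into_f[OF y] t by simp
qed


section \<open>Isometries and spaces with midpoints\<close>

lemma isom_group_group: "group (isom_group :: ('z::metric_space \<Rightarrow> 'z) monoid)"
proof (rule groupI)
  fix h :: "'z \<Rightarrow> 'z" assume "h \<in> carrier isom_group"
  then have h: "bij h" "\<And>x y. dist (h x) (h y) = dist x y" by (auto simp: isom_group_def)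
  define k where "k = inv_into UNIV h"
  have k: "bij k" "\<And>x. h (k x) = x" "\<And>x. k (h x) = x"
    using h(1) by (simp_all add: k_def bij_imp_bij_inv bij_is_inj bij_is_surj surj_f_inv_f)
  have "dist (k x) (k y) = dist x y" for x y
    using h(2)[of "k x" "k y"] k(2) by simp
  then show "\<exists>k\<in>carrier isom_group. k \<otimes>\<^bsub>isom_group\<^esub> h = \<one>\<^bsub>isom_group\<^esub>"
    using k by (intro bexI[of _ k]) (simp_all add: isom_group_def fun_eq_iff)
qed (simp_all add: isom_group_def bij_comp comp_assoc)

lemma isom_groupD:
  assumes "h \<in> carrier (isom_group :: ('z::metric_space \<Rightarrow> 'z) monoid)"
  shows "bij h" "dist (h x) (h y) = dist x y"
  using assms by (auto simp: isom_group_def)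

lemma isom_group_continuous:
  assumes "h \<in> carrier (isom_group :: ('z::metric_space \<Rightarrow> 'z) monoid)"
  shows "continuous_on A h"
  using assms by (auto simp: isom_group_def continuous_on_iff)

lemma isom_subgroup_inverse:
  assumes "subgroup H (isom_group :: ('z::metric_space \<Rightarrow> 'z) monoid)" "h \<in> H"
  shows "\<exists>k\<in>H. (\<forall>x. h (k x) = x) \<and> (\<forall>x. k (h x) = x)"
proof -
  interpret subgroup H isom_group by fact
  interpret group "isom_group :: ('z \<Rightarrow> 'z) monoid" by (rule isom_group_group)
  let ?k = "inv\<^bsub>isom_group\<^esub> h"
  have "h \<circ> ?k = id" "?k \<circ> h = id"
    using r_inv[of h] l_inv[of h] mem_carrier[OF assms(2)] by (auto simp: isom_group_def)
  then have "\<And>x. h (?k x) = x" "\<And>x. ?k (h x) = x" by (auto simp: fun_eq_iff)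
  then show ?thesis using assms(2) by blast
qed

lemma isom_subgroup_comp:
  assumes "subgroup H (isom_group :: ('z::metric_space \<Rightarrow> 'z) monoid)" "h \<in> H" "k \<in> H"
  shows "h \<circ> k \<in> H"
  using subgroup.m_closed[OF assms] by (simp add: isom_group_def)

text \<open>
  The two kinds of spaces enter the argument only through the following properties. The last one
  provides points that are fixed by a compact group; in the applications the group is the
  stabiliser of a vertex and \<open>S\<close> is the whole space or a sublevel set of a convex function.
\<close>

locale midpoint_space =
  fixes mid :: "'z::complete_space \<Rightarrow> 'z \<Rightarrow> 'z"
  assumes mid_idem: "mid x x = x"
    and mid_commute: "mid x y = mid y x"
    and mid_busemann: "dist (mid x z) (mid y z) \<le> dist x y / 2"
    and mid_isometry: "h \<in> carrier isom_group \<Longrightarrow> h (mid x y) = mid (h x) (h y)"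
    and compact_group_fixed_point:
      "\<lbrakk>subgroup H isom_group; \<And>x. compact ((\<lambda>h. h x) ` H); closed S; S \<noteq> {};
        \<And>x y. x \<in> S \<Longrightarrow> y \<in> S \<Longrightarrow> mid x y \<in> S; \<And>h x. h \<in> H \<Longrightarrow> x \<in> S \<Longrightarrow> h x \<in> S\<rbrakk>
       \<Longrightarrow> \<exists>p\<in>S. \<forall>h\<in>H. h p = p"
begin

text \<open>
  Moving the two end points one at a time, through \<open>mid c b\<close>, turns the triangle version of the
  Busemann inequality into its version for quadrilaterals.
\<close>

lemma dist_mid_mid_le: "dist (mid a b) (mid c e) \<le> (dist a c + dist b e) / 2"
proof -
  have "dist (mid a b) (mid c e) \<le> dist (mid a b) (mid c b) + dist (mid c b) (mid c e)"
    by (rule dist_triangle)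
  also have "\<dots> \<le> dist a c / 2 + dist b e / 2"
    using mid_busemann[of a b c] mid_busemann[of b c e] by (simp add: mid_commute add_mono)
  finally show ?thesis by simp
qed

lemma dist_mid_left: "dist x (mid x y) \<le> dist x y / 2"
  using dist_mid_mid_le[of x x x y] by (simp add: mid_idem)

end


section \<open>Busemann spaces\<close>

text \<open>
  The fixed point is the Chebyshev centre of an orbit relative to \<open>S\<close>: among the points of \<open>S\<close>
  the smallest radius \<open>R\<close> of a ball containing the orbit is attained exactly once. Two candidates
  of radius about \<open>R\<close> that are far apart would have, by uniform convexity, a midpoint of radius
  less than \<open>R\<close>; so near-optimal points form a Cauchy sequence, and its limit is unique, hence
  invariant.
\<close>

lemma uniformly_convex_fixed_point:
  fixes S :: "'z::complete_space set"
  assumes uc: "metric_uniformly_convex TYPE('z)"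
    and H: "subgroup H isom_group" and bdd: "\<And>x. bounded ((\<lambda>h. h x) ` H)"
    and S: "closed S" "S \<noteq> {}" and mS: "\<And>x y. x \<in> S \<Longrightarrow> y \<in> S \<Longrightarrow> geodesic_midpoint x y \<in> S"
    and inv: "\<And>h x. h \<in> H \<Longrightarrow> x \<in> S \<Longrightarrow> h x \<in> S"
  shows "\<exists>p\<in>S. \<forall>h\<in>H. h p = p"
proof -
  interpret H: subgroup H isom_group by fact
  obtain s0 where s0: "s0 \<in> S" using S by auto
  define orb where "orb = (\<lambda>h. h s0) ` H"
  define P where "P x r \<longleftrightarrow> (\<forall>s\<in>orb. dist x s \<le> r)" for x r
  define A where "A = {r. \<exists>x\<in>S. P x r}"
  define R where "R = Inf A"
  have orb_ne: "orb \<noteq> {}" using H.one_closed unfolding orb_def by blast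
  have "\<exists>r. P s0 r" using bounded_any_center[of orb s0] bdd[of s0] by (auto simp: P_def orb_def)
  then have A_ne: "A \<noteq> {}" using s0 by (auto simp: A_def)
  have A_nonneg: "0 \<le> r" if "r \<in> A" for r
    using that orb_ne zero_le_dist order.trans unfolding A_def P_def by blast
  then have bdd_A: "bdd_below A" by (meson bdd_belowI)
  have R0: "0 \<le> R" unfolding R_def using A_nonneg A_ne by (meson cInf_greatest)
  have R_le: "R \<le> r" if "x \<in> S" "P x r" for x r
    unfolding R_def using bdd_A that by (auto intro!: cInf_lower simp: A_def)
  have P_near: "\<exists>x\<in>S. P x (R + \<delta>)" if pos: "\<delta> > 0" for \<delta>
  proof -
    obtain r where "r \<in> A" "r < R + \<delta>"
      using cInf_lessD[OF A_ne, of "R + \<delta>"] pos by (auto simp: R_def)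
    then show ?thesis unfolding A_def P_def by force
  qed
  obtain \<theta> :: "real \<Rightarrow> real \<Rightarrow> real" where
    \<theta>: "\<And>r \<epsilon>. r > 0 \<Longrightarrow> \<epsilon> \<in> {0<..2} \<Longrightarrow> \<theta> r \<epsilon> \<in> {0<..1}"
    and \<theta>mid: "\<And>r \<epsilon> a x y::'z. r > 0 \<Longrightarrow> \<epsilon> \<in> {0<..2} \<Longrightarrow> dist a x \<le> r \<Longrightarrow> dist a y \<le> r \<Longrightarrow>
        dist x y \<ge> \<epsilon> * r \<Longrightarrow> dist (geodesic_midpoint x y) a \<le> (1 - \<theta> r \<epsilon>) * r"
    and \<theta>inf: "\<And>\<epsilon>. \<epsilon> \<in> {0<..2} \<Longrightarrow> (INF r\<in>{0<..}. \<theta> r \<epsilon>) > 0"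
    using uc unfolding metric_uniformly_convex_def by blast
  have close: "\<exists>\<delta>>0. \<forall>x\<in>S. \<forall>y\<in>S. P x (R + \<delta>) \<longrightarrow> P y (R + \<delta>) \<longrightarrow> dist x y < e"
    if e: "e > 0" for e
  proof (cases "R = 0")
    case True
    obtain s where "s \<in> orb" using orb_ne by auto
    then have "dist x y < e" if "P x (R + e/3)" "P y (R + e/3)" for x y
      using that True e dist_triangle2[of x y s] unfolding P_def by force
    then show ?thesis using e by (intro exI[of _ "e/3"]) auto
  next
    case False
    with R0 have R: "R > 0" by simp
    \<comment> \<open>With this \<open>\<epsilon>\<close>, points at distance \<open>e\<close> are \<open>\<epsilon>\<close>-separated at every scale up to \<open>2 * R\<close>.\<close>
    define \<epsilon> where "\<epsilon> = min 2 (e / (2 * R))"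
    have \<epsilon>: "\<epsilon> \<in> {0<..2}" "\<epsilon> * (2 * R) \<le> e" using R e by (auto simp: \<epsilon>_def min_def field_simps)
    define t where "t = (INF r\<in>{0<..}. \<theta> r \<epsilon>)"
    have t_le: "t \<le> \<theta> r \<epsilon>" if "r > 0" for r
      unfolding t_def using that \<theta>[OF _ \<epsilon>(1)]
      by (intro cINF_lower bdd_belowI2[where m=0]) (auto intro: less_imp_le)
    have t: "0 < t" "t \<le> 1" using \<theta>inf[OF \<epsilon>(1)] t_le[of 1] \<theta>[OF _ \<epsilon>(1), of 1] by (auto simp: t_def)
    \<comment> \<open>Small enough for \<open>(1 - t) * (R + \<delta>) < R\<close>, so that a midpoint beats the infimum.\<close>
    define \<delta> where "\<delta> = R * t / 2"
    have \<delta>: "\<delta> > 0" "\<delta> \<le> R" using R t mult_left_mono[of t 1 R] by (auto simp: \<delta>_def)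
    have less: "(1 - t) * (R + \<delta>) < R"
    proof -
      have "(1 - t) * (R + \<delta>) = R - (R * t / 2) * (1 + t)"
        unfolding \<delta>_def by (simp add: field_simps power2_eq_square)
      also have "\<dots> < R" using R t by simp
      finally show ?thesis .
    qed
    have "dist x y < e" if xy: "x \<in> S" "y \<in> S" "P x (R + \<delta>)" "P y (R + \<delta>)" for x y
    proof (rule ccontr)
      assume "\<not> dist x y < e"
      moreover have "\<epsilon> * (R + \<delta>) \<le> \<epsilon> * (2 * R)" using \<epsilon> \<delta> by (intro mult_left_mono) auto
      ultimately have far: "dist x y \<ge> \<epsilon> * (R + \<delta>)"
        using \<epsilon>(2) \<open>\<epsilon> * (R + \<delta>) \<le> \<epsilon> * (2 * R)\<close> by linarith
      have "P (geodesic_midpoint x y) ((1 - t) * (R + \<delta>))"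
        unfolding P_def
      proof
        fix s assume s: "s \<in> orb"
        have "dist (geodesic_midpoint x y) s \<le> (1 - \<theta> (R + \<delta>) \<epsilon>) * (R + \<delta>)"
          using xy s \<theta>mid[OF _ \<epsilon>(1) _ _ far, of s] R \<delta> by (auto simp: P_def dist_commute)
        also have "\<dots> \<le> (1 - t) * (R + \<delta>)"
          using t_le[of "R + \<delta>"] R \<delta> by (intro mult_right_mono) auto
        finally show "dist (geodesic_midpoint x y) s \<le> (1 - t) * (R + \<delta>)" .
      qed
      then show False using R_le[OF mS[OF xy(1,2)]] less by fastforce
    qed
    then show ?thesis using \<delta> by blast
  qed
  have "\<forall>n. \<exists>x\<in>S. P x (R + 1 / Suc n)" by (intro allI P_near) simp
  then obtain X where X: "\<And>n. X n \<in> S" "\<And>n. P (X n) (R + 1 / Suc n)" by metis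
  have P_mono: "P x r'" if "P x r" "r \<le> r'" for x r r' using that by (force simp: P_def)
  have "Cauchy X"
  proof (rule metric_CauchyI)
    fix e :: real assume "e > 0"
    then obtain \<delta> where \<delta>: "\<delta> > 0"
      "\<And>x y. x \<in> S \<Longrightarrow> y \<in> S \<Longrightarrow> P x (R + \<delta>) \<Longrightarrow> P y (R + \<delta>) \<Longrightarrow> dist x y < e"
      using close by meson
    then obtain M where M: "1 / Suc M < \<delta>" using nat_approx_posE by metis
    have "P (X n) (R + \<delta>)" if "n \<ge> M" for n
    proof (rule P_mono[OF X(2)])
      have "1 / real (Suc n) \<le> 1 / real (Suc M)" using that by (simp add: frac_le)
      then show "R + 1 / Suc n \<le> R + \<delta>" using M by simp
    qed
    then show "\<exists>M. \<forall>m\<ge>M. \<forall>n\<ge>M. dist (X m) (X n) < e" using \<delta>(2) X(1) by blast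
  qed
  then obtain p where p: "X \<longlonglongrightarrow> p" using Cauchy_convergent convergent_def by blast
  have pS: "p \<in> S" using closed_sequentially[OF S(1) _ p] X(1) by blast
  have pR: "P p R"
    unfolding P_def
  proof
    fix s assume s: "s \<in> orb"
    have "(\<lambda>n. R + 1 / real (Suc n)) \<longlonglongrightarrow> R + 0"
      using LIMSEQ_inverse_real_of_nat by (intro tendsto_intros) (simp add: inverse_eq_divide)
    moreover have "(\<lambda>n. dist (X n) s) \<longlonglongrightarrow> dist p s" using p by (intro tendsto_intros)
    ultimately show "dist p s \<le> R"
      using X(2) s unfolding P_def by (metis (no_types, lifting) LIMSEQ_le add.right_neutral)
  qed
  have "h p = p" if h: "h \<in> H" for h
  proof -
    obtain k where k: "k \<in> H" "\<And>x. h (k x) = x" "\<And>x. k (h x) = x"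
      using isom_subgroup_inverse[OF H h] by blast
    have "P (h p) R"
      unfolding P_def
    proof
      fix s assume s: "s \<in> orb"
      then obtain l where "l \<in> H" "s = l s0" by (auto simp: orb_def)
      then have "k s \<in> orb"
        using isom_subgroup_comp[OF H k(1), of l] by (auto simp: orb_def intro: image_eqI[of _ _ "k \<circ> l"])
      moreover have "dist (h p) s = dist p (k s)"
        using isom_groupD(2)[OF H.mem_carrier[OF h], of p "k s"] k(2) by simp
      ultimately show "dist (h p) s \<le> R" using pR by (simp add: P_def)
    qed
    have less: "dist (h p) p < e" if "e > 0" for e
    proof -
      obtain \<delta> where \<delta>: "\<delta> > 0" and
        *: "\<And>x y. x \<in> S \<Longrightarrow> y \<in> S \<Longrightarrow> P x (R + \<delta>) \<Longrightarrow> P y (R + \<delta>) \<Longrightarrow> dist x y < e"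
        using close[OF \<open>e > 0\<close>] by blast
      show ?thesis
        using \<delta> by (intro * inv[OF h pS] pS P_mono[OF \<open>P (h p) R\<close>] P_mono[OF pR]) simp_all
    qed
    show ?thesis using less[of "dist (h p) p"] by (cases "h p = p") simp_all
  qed
  then show ?thesis using pS by blast
qed

lemma geodesic_midpoint_eqI:
  assumes "uniquely_geodesic TYPE('z::metric_space)" "geodesic c x (y::'z)"
  shows "geodesic_midpoint x y = c (dist x y / 2)"
  unfolding geodesic_midpoint_def
proof (rule the_equality)
  fix z assume "\<exists>c. geodesic c x y \<and> z = c (dist x y / 2)"
  then show "z = c (dist x y / 2)"
    using assms unfolding uniquely_geodesic_def by fastforce
qed (use assms in blast)

lemma busemann_midpoint_space:
  assumes ug: "uniquely_geodesic TYPE('z::complete_space)"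
    and uc: "metric_uniformly_convex TYPE('z)" and bu: "busemann_nonpos_curved TYPE('z)"
  shows "midpoint_space (geodesic_midpoint :: 'z \<Rightarrow> 'z \<Rightarrow> 'z)"
proof
  fix x y z :: 'z
  have ex: "\<exists>c. geodesic c x y" for x y :: 'z using ug unfolding uniquely_geodesic_def by blast
  obtain c where c: "geodesic c x x" using ex by blast
  show "geodesic_midpoint x x = x" using geodesic_midpoint_eqI[OF ug c] c by (simp add: geodesic_def)
  obtain c where c: "geodesic c x y" using ex by blast
  have "geodesic (\<lambda>t. c (dist x y - t)) y x"
    using c unfolding geodesic_def by (auto simp: dist_commute)
  from geodesic_midpoint_eqI[OF ug this] geodesic_midpoint_eqI[OF ug c]
  show "geodesic_midpoint x y = geodesic_midpoint y x" by (simp add: dist_commute)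
  show "dist (geodesic_midpoint x z) (geodesic_midpoint y z) \<le> dist x y / 2"
    using bu unfolding busemann_nonpos_curved_def by blast
  fix h :: "'z \<Rightarrow> 'z" assume h: "h \<in> carrier isom_group"
  have "geodesic (h \<circ> c) (h x) (h y)"
    using c isom_groupD(2)[OF h] unfolding geodesic_def by simp
  from geodesic_midpoint_eqI[OF ug this] geodesic_midpoint_eqI[OF ug c]
  show "h (geodesic_midpoint x y) = geodesic_midpoint (h x) (h y)"
    using isom_groupD(2)[OF h] by simp
next
  fix H and S :: "'z set"
  assume "subgroup H isom_group" "\<And>x::'z. compact ((\<lambda>h. h x) ` H)" "closed S" "S \<noteq> {}"
    "\<And>x y. x \<in> S \<Longrightarrow> y \<in> S \<Longrightarrow> geodesic_midpoint x y \<in> S"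
    "\<And>h x. h \<in> H \<Longrightarrow> x \<in> S \<Longrightarrow> h x \<in> S"
  then show "\<exists>p\<in>S. \<forall>h\<in>H. h p = p"
    using uniformly_convex_fixed_point[OF uc] compact_imp_bounded by blast
qed


section \<open>Banach spaces\<close>

text \<open>
  The Mazur-Ulam theorem. A bijective isometry fixing \<open>a\<close> and \<open>b\<close> moves their midpoint \<open>z\<close> by
  some distance; its commutator with the reflection in \<open>z\<close> is another such isometry and moves \<open>z\<close>
  twice as far. As the displacement is at most \<open>2 * dist a z\<close>, it vanishes. The case of an
  arbitrary isometry follows by composing it with the reflections in the two midpoints.
\<close>

lemma isometry_fixes_midpoint:
  fixes g :: "'b::real_normed_vector \<Rightarrow> 'b"
  assumes "g \<in> carrier isom_group" "g a = a" "g b = b"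
  shows "g (midpoint a b) = midpoint a b"
proof (rule ccontr)
  define z where "z = midpoint a b"
  define W where "W = {g \<in> carrier isom_group. g a = a \<and> g b = b}"
  define \<psi> where "\<psi> x = 2 *\<^sub>R z - x" for x :: 'b
  interpret I: group "isom_group :: ('b \<Rightarrow> 'b) monoid" by (rule isom_group_group)
  have \<psi>\<psi>: "\<psi> (\<psi> x) = x" for x by (simp add: \<psi>_def)
  have \<psi>: "\<psi> z = z" "\<psi> a = b" "\<psi> b = a"
    by (simp_all add: \<psi>_def z_def scaleR_2 diff_eq_eq)
  have \<psi>_isom: "\<psi> \<in> carrier isom_group"
    using \<psi>\<psi> by (auto simp: isom_group_def dist_norm \<psi>_def norm_minus_commute intro!: o_bij[of \<psi>])
  have double: "\<exists>k\<in>W. dist (k z) z = 2 * dist (h z) z" if h: "h \<in> W" for h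
  proof -
    obtain k where k: "k \<in> carrier isom_group" "\<And>x. h (k x) = x" "\<And>x. k (h x) = x"
      using isom_subgroup_inverse[OF I.subgroup_self, of h] h unfolding W_def by blast
    let ?l = "\<psi> \<circ> (k \<circ> (\<psi> \<circ> h))"
    have "?l \<in> carrier isom_group"
      using isom_subgroup_comp[OF I.subgroup_self] \<psi>_isom k(1) h by (simp add: W_def)
    moreover have "k a = a" "k b = b" using h k(3)[of a] k(3)[of b] by (simp_all add: W_def)
    ultimately have "?l \<in> W" using h \<psi> by (simp add: W_def)
    moreover have "dist (?l z) z = 2 * dist (h z) z"
    proof -
      have "dist (?l z) z = dist (k (\<psi> (h z))) z"
        using isom_groupD(2)[OF \<psi>_isom, of "k (\<psi> (h z))" z] \<psi>(1) by simp
      also have "\<dots> = dist (\<psi> (h z)) (h z)"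
        using isom_groupD(2)[of h "k (\<psi> (h z))" z] h k(2) by (simp add: W_def)
      also have "\<dots> = norm (2 *\<^sub>R (z - h z))"
        by (simp add: dist_norm \<psi>_def scaleR_2 algebra_simps)
      finally show ?thesis by (simp add: dist_norm norm_minus_commute)
    qed
    ultimately show ?thesis by blast
  qed
  have bounded: "dist (h z) z \<le> 2 * dist a z" if "h \<in> W" for h
  proof -
    have "dist (h z) z \<le> dist (h z) (h a) + dist (h a) z" by (rule dist_triangle)
    also have "\<dots> = 2 * dist a z"
      using that isom_groupD(2)[of h z a] by (simp add: W_def dist_commute)
    finally show ?thesis .
  qed
  have iterate: "\<exists>k\<in>W. dist (k z) z = 2 ^ n * dist (g z) z" for n
  proof (induction n)
    case 0
    then show ?case using assms by (auto simp: W_def)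
  next
    case (Suc n)
    then obtain k where k: "k \<in> W" "dist (k z) z = 2 ^ n * dist (g z) z" by blast
    from double[OF k(1)] obtain l where "l \<in> W" "dist (l z) z = 2 * dist (k z) z" by blast
    with k(2) show ?case by (intro bexI[of _ l]) simp_all
  qed
  assume "g (midpoint a b) \<noteq> midpoint a b"
  then have "dist (g z) z > 0" by (simp add: z_def)
  then obtain n where "2 * dist a z / dist (g z) z < 2 ^ n"
    using real_arch_pow[of 2] by auto
  then have "2 * dist a z < 2 ^ n * dist (g z) z"
    using \<open>dist (g z) z > 0\<close> by (simp add: field_simps)
  moreover obtain k where "k \<in> W" "dist (k z) z = 2 ^ n * dist (g z) z" using iterate by blast
  ultimately show False using bounded[of k] by simp
qed

lemma isometry_midpoint:
  fixes h :: "'b::real_normed_vector \<Rightarrow> 'b"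
  assumes h: "h \<in> carrier isom_group"
  shows "h (midpoint a b) = midpoint (h a) (h b)"
proof -
  interpret I: group "isom_group :: ('b \<Rightarrow> 'b) monoid" by (rule isom_group_group)
  define refl where "refl z x = 2 *\<^sub>R z - x" for z x :: 'b
  have refl_isom: "refl z \<in> carrier isom_group" for z
    by (auto simp: isom_group_def dist_norm refl_def norm_minus_commute intro!: o_bij[of "refl z"])
  have refl_mid: "refl (midpoint x y) x = y" "refl (midpoint x y) y = x" for x y
    by (simp_all add: refl_def scaleR_2 diff_eq_eq)
  have refl_fix: "y = z" if "refl z y = z" for y z
    using that by (simp add: refl_def scaleR_2 diff_eq_eq)
  obtain k where k: "k \<in> carrier isom_group" "\<And>x. h (k x) = x" "\<And>x. k (h x) = x"
    using isom_subgroup_inverse[OF I.subgroup_self h] by blast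
  let ?z = "midpoint a b" and ?w = "midpoint (h a) (h b)"
  let ?g = "refl ?z \<circ> (k \<circ> (refl ?w \<circ> h))"
  have "?g \<in> carrier isom_group"
    using isom_subgroup_comp[OF I.subgroup_self] refl_isom k(1) h by simp
  then have g_fix: "?g ?z = ?z"
    by (rule isometry_fixes_midpoint) (simp_all add: refl_mid k(3))
  have "k (refl ?w (h ?z)) = ?z"
    by (rule refl_fix) (use g_fix in \<open>simp only: o_apply\<close>)
  then have "refl ?w (h ?z) = h ?z" using k(2) by metis
  then have "2 *\<^sub>R ?w = 2 *\<^sub>R h ?z" unfolding refl_def by (simp add: scaleR_2 diff_eq_eq)
  then show ?thesis by (metis scaleR_cancel_left zero_neq_numeral)
qed

text \<open>
  Bisecting \<open>k\<close> times reaches the points of a segment whose parameters are multiples of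
  \<open>1 / 2 ^ k\<close>; these are dense in the segment.
\<close>

lemma closed_midpoint_convex:
  fixes S :: "'b::real_normed_vector set"
  assumes "closed S" and mid: "\<And>x y. x \<in> S \<Longrightarrow> y \<in> S \<Longrightarrow> midpoint x y \<in> S"
  shows "convex S"
proof (rule convexI)
  fix x y :: 'b and u v :: real
  assume xy: "x \<in> S" "y \<in> S" and uv: "0 \<le> u" "0 \<le> v" "u + v = 1"
  define p where "p t = x + t *\<^sub>R (y - x)" for t :: real
  have p_mid: "midpoint (p s) (p t) = p ((s + t) / 2)" for s t
  proof -
    have "2 *\<^sub>R p ((s + t) / 2) = 2 *\<^sub>R x + (s + t) *\<^sub>R (y - x)"
      unfolding p_def by (simp only: scaleR_add_right scaleR_scaleR) simp
    also have "\<dots> = p s + p t" unfolding p_def by (simp only: scaleR_add_left scaleR_2) simp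
    finally have "inverse 2 *\<^sub>R (p s + p t) = inverse 2 *\<^sub>R (2 *\<^sub>R p ((s + t) / 2))" by simp
    then show ?thesis by (simp add: midpoint_def)
  qed
  have dyadic: "j \<le> 2 ^ k \<Longrightarrow> p (real j / 2 ^ k) \<in> S" for j k
  proof (induction k arbitrary: j)
    case 0
    then have "j = 0 \<or> j = 1" by auto
    then show ?case using xy by (auto simp: p_def)
  next
    case (Suc k)
    have "j div 2 \<le> 2 ^ k" "(j + 1) div 2 \<le> 2 ^ k" using Suc.prems by auto
    then have "midpoint (p (real (j div 2) / 2 ^ k)) (p (real ((j + 1) div 2) / 2 ^ k)) \<in> S"
      using Suc.IH mid by blast
    moreover have "real (j div 2) + real ((j + 1) div 2) = real j"
      unfolding of_nat_add[symmetric] of_nat_eq_iff by presburger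
    ultimately show ?case by (simp add: p_mid add_divide_distrib[symmetric] field_simps)
  qed
  have v1: "v \<le> 1" using uv by simp
  define q where "q k = real (nat \<lfloor>v * 2 ^ k\<rfloor>) / 2 ^ k" for k
  have "nat \<lfloor>v * 2 ^ k\<rfloor> \<le> 2 ^ k" for k :: nat
  proof -
    have "v * 2 ^ k \<le> 2 ^ k" using uv v1 by (intro mult_left_le_one_le) auto
    from floor_mono[OF this] have "\<lfloor>v * 2 ^ k\<rfloor> \<le> 2 ^ k" by (simp only: floor_numeral_power)
    then show ?thesis by (simp add: nat_le_iff)
  qed
  then have qS: "p (q k) \<in> S" for k unfolding q_def by (rule dyadic)
  have "\<bar>q k - v\<bar> \<le> (1/2) ^ k" for k
  proof -
    define r where "r = real (nat \<lfloor>v * 2 ^ k\<rfloor>)"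
    have "r \<le> v * 2 ^ k" "v * 2 ^ k - 1 \<le> r"
      using zero_le_mult_iff[of v "2 ^ k"] uv(2) unfolding r_def by (linarith | simp)+
    then have "\<bar>r - v * 2 ^ k\<bar> / 2 ^ k \<le> 1 / 2 ^ k" by (intro divide_right_mono) auto
    moreover have "q k - v = (r - v * 2 ^ k) / 2 ^ k" by (simp add: q_def r_def diff_divide_distrib)
    ultimately show ?thesis by (simp add: abs_divide power_one_over)
  qed
  then have "\<forall>\<^sub>F k in sequentially. norm (q k - v) \<le> (1/2) ^ k" by (intro always_eventually) simp
  moreover have "(\<lambda>k. (1/2 :: real) ^ k) \<longlonglongrightarrow> 0" by (intro LIMSEQ_realpow_zero) auto
  ultimately have "(\<lambda>k. q k - v) \<longlonglongrightarrow> 0" by (rule Lim_null_comparison)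
  then have "q \<longlonglongrightarrow> v" using LIM_zero_cancel by blast
  then have "(\<lambda>k. p (q k)) \<longlonglongrightarrow> p v" unfolding p_def by (intro tendsto_intros)
  then have "p v \<in> S" by (rule closed_sequentially[OF assms(1) qS])
  moreover have "p v = u *\<^sub>R x + v *\<^sub>R y"
  proof -
    have "u = 1 - v" using uv(3) by simp
    show ?thesis unfolding \<open>u = 1 - v\<close> by (simp add: p_def algebra_simps)
  qed
  ultimately show "u *\<^sub>R x + v *\<^sub>R y \<in> S" by simp
qed

text \<open>
  Up to a small error the hull of a compact set is the hull of a finite net, which is compact and
  so has a finite net itself.
\<close>

lemma compact_closure_convex_hull:
  fixes K :: "'b::banach set"
  assumes "compact K"
  shows "compact (closure (convex hull K))"
  unfolding compact_eq_totally_bounded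
proof (intro conjI allI impI)
  show "complete (closure (convex hull K))" by (simp add: complete_eq_closed)
  fix e :: real assume "e > 0"
  then obtain F where F: "finite F" "K \<subseteq> (\<Union>x\<in>F. ball x (e/3))"
    using assms unfolding compact_eq_totally_bounded by (metis divide_pos_pos zero_less_numeral)
  have "compact (convex hull F)" by (rule finite_imp_compact_convex_hull[OF F(1)])
  then obtain E where E: "finite E" "convex hull F \<subseteq> (\<Union>x\<in>E. ball x (e/3))"
    using \<open>e > 0\<close> unfolding compact_eq_totally_bounded by (metis divide_pos_pos zero_less_numeral)
  let ?U = "\<Union>x\<in>convex hull F. \<Union>y\<in>ball 0 (e/3). {x + y}"
  have "K \<subseteq> ?U"
  proof
    fix x assume "x \<in> K"
    then obtain y where y: "y \<in> F" "x \<in> ball y (e/3)" using F by auto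
    then have "y \<in> convex hull F" "x - y \<in> ball 0 (e/3)" "x \<in> {y + (x - y)}"
      using hull_inc[of y F convex] by (simp_all add: dist_norm norm_minus_commute)
    then show "x \<in> ?U" by blast
  qed
  then have hull: "convex hull K \<subseteq> ?U"
    by (intro hull_minimal convex_sums) auto
  have "closure (convex hull K) \<subseteq> (\<Union>x\<in>E. ball x e)"
  proof
    fix z assume "z \<in> closure (convex hull K)"
    then obtain w where w: "w \<in> convex hull K" "dist w z < e/3"
      using \<open>e > 0\<close> unfolding closure_approachable by (metis divide_pos_pos zero_less_numeral)
    obtain x y where x: "x \<in> convex hull F" and y: "norm y < e/3" "w = x + y"
      using hull w by auto
    obtain c where c: "c \<in> E" "dist c x < e/3" using E x by auto
    have "dist c z \<le> dist c x + dist x w + dist w z"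
      using dist_triangle[of c z x] dist_triangle[of x z w] by linarith
    also have "\<dots> < e" using c w y by (simp add: dist_norm)
    finally show "z \<in> (\<Union>x\<in>E. ball x e)" using c by auto
  qed
  then show "\<exists>k. finite k \<and> closure (convex hull K) \<subseteq> (\<Union>x\<in>k. ball x e)" using E by blast
qed

text \<open>
  Compact convex sets have normal structure: the barycentre of a finite net with mesh half the
  diameter \<open>d\<close> has distance at most \<open>(1 - 1 / (2 * n)) * d\<close> from every point, where \<open>n\<close> is the size
  of the net, because at least one of the \<open>n\<close> distances that are averaged is at most \<open>d / 2\<close>.
\<close>

lemma compact_convex_normal_structure:
  fixes C :: "'b::real_normed_vector set"
  assumes C: "compact C" "convex C" and ab: "a \<in> C" "b \<in> C" "a \<noteq> b"
  obtains x r u v where "x \<in> C" "\<And>y. y \<in> C \<Longrightarrow> dist x y \<le> r" "u \<in> C" "v \<in> C" "r < dist u v"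
proof -
  obtain u v where uv: "u \<in> C" "v \<in> C" and d: "\<And>x y. x \<in> C \<Longrightarrow> y \<in> C \<Longrightarrow> dist x y \<le> dist u v"
    using compact_sup_maxdistance[OF C(1)] ab by blast
  define d where "d = dist u v"
  have d_pos: "d > 0" using order_less_le_trans[OF _ d[OF ab(1,2)], of 0] ab(3) unfolding d_def by force
  obtain F where F: "finite F" "F \<subseteq> C" "C \<subseteq> (\<Union>x\<in>F. ball x (d/2))"
    using seq_compact_imp_totally_bounded[of C] C(1) d_pos compact_imp_seq_compact
    by (metis half_gt_zero)
  define n where "n = real (card F)"
  have "F \<noteq> {}" using F uv by auto
  then have n: "n \<ge> 1" using F(1) by (simp add: n_def Suc_leI card_gt_0_iff)
  define x where "x = (\<Sum>z\<in>F. (1 / n) *\<^sub>R z)"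
  have sum1: "(\<Sum>z\<in>F. 1 / n) = 1" using n by (simp add: n_def)
  have xC: "x \<in> C" unfolding x_def using F n sum1 by (intro convex_sum C) auto
  have "dist x y \<le> d - d / (2 * n)" if y: "y \<in> C" for y
  proof -
    obtain z0 where z0: "z0 \<in> F" "dist z0 y < d/2" using F(3) y by auto
    have "y = (\<Sum>z\<in>F. 1 / n) *\<^sub>R y" using sum1 by simp
    then have "x - y = (\<Sum>z\<in>F. (1 / n) *\<^sub>R (z - y))"
      by (simp only: x_def scaleR_sum_left scaleR_diff_right sum_subtractf)
    then have "dist x y \<le> (\<Sum>z\<in>F. (1 / n) * dist z y)"
      using n norm_sum[of "\<lambda>z. (1 / n) *\<^sub>R (z - y)" F] by (simp add: dist_norm)
    also have "\<dots> = (1 / n) * dist z0 y + (\<Sum>z\<in>F - {z0}. (1 / n) * dist z y)"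
      by (rule sum.remove[OF F(1) z0(1)])
    also have "\<dots> \<le> (1 / n) * (d / 2) + (\<Sum>z\<in>F - {z0}. (1 / n) * d)"
      using n z0 d F(2) y unfolding d_def
      by (intro add_mono sum_mono mult_left_mono) auto
    also have "\<dots> = (\<Sum>z\<in>F. (1 / n) * d) - d / (2 * n)"
      unfolding sum.remove[OF F(1) z0(1), of "\<lambda>_. (1 / n) * d"] using n by (simp add: field_simps)
    also have "(\<Sum>z\<in>F. (1 / n) * d) = d" using sum1 by (simp add: sum_distrib_right[symmetric])
    finally show ?thesis .
  qed
  moreover have "d - d / (2 * n) < dist u v" using d_pos n by (simp add: d_def)
  ultimately show ?thesis using that xC uv by blast
qed

text \<open>
  The closed convex hull of an orbit is an invariant compact convex set, because isometries
  preserve midpoints. A minimal set of this kind is a single point: otherwise, with \<open>r\<close> from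
  \<open>compact_convex_normal_structure\<close>, the points whose distance from all the others is at most \<open>r\<close>
  would form a smaller one.
\<close>

lemma banach_compact_group_fixed_point:
  fixes S :: "'b::banach set"
  assumes H: "subgroup H isom_group" and cpt: "\<And>x::'b. compact ((\<lambda>h. h x) ` H)"
    and S: "closed S" "S \<noteq> {}"
    and mS: "\<And>x y. x \<in> S \<Longrightarrow> y \<in> S \<Longrightarrow> midpoint x y \<in> S"
    and inv: "\<And>h x. h \<in> H \<Longrightarrow> x \<in> S \<Longrightarrow> h x \<in> S"
  shows "\<exists>p\<in>S. \<forall>h\<in>H. h p = p"
proof -
  interpret H: subgroup H isom_group by fact
  define good where
    "good C \<longleftrightarrow> C \<subseteq> S \<and> C \<noteq> {} \<and> compact C \<and> convex C \<and> (\<forall>h\<in>H. \<forall>x\<in>C. h x \<in> C)" for C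
  obtain s0 where s0: "s0 \<in> S" using S by auto
  define K where "K = closure (convex hull ((\<lambda>h. h s0) ` H))"
  have K_min: "K \<subseteq> A" if "(\<lambda>h. h s0) ` H \<subseteq> A" "closed A" "convex A" for A
    unfolding K_def using that by (simp add: closure_minimal hull_minimal)
  have orbit_K: "(\<lambda>h. h s0) ` H \<subseteq> K"
    unfolding K_def by (meson closure_subset hull_subset order_trans)
  have "good K"
    unfolding good_def
  proof (intro conjI ballI)
    show "K \<subseteq> S" using s0 inv by (intro K_min S closed_midpoint_convex[OF S(1) mS]) auto
    show "K \<noteq> {}" using orbit_K H.one_closed by blast
    show "compact K" unfolding K_def by (rule compact_closure_convex_hull[OF cpt])
    show cK: "convex K" unfolding K_def by (intro convex_closure convex_convex_hull)
    fix h x assume h: "h \<in> H" and x: "x \<in> K"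
    note h' = H.mem_carrier[OF h]
    have "closed (h -` K)"
      using isom_group_continuous[OF h', of UNIV] unfolding K_def
      by (intro continuous_closed_vimage) (auto simp: continuous_on_eq_continuous_at)
    moreover have "midpoint y z \<in> h -` K" if "y \<in> h -` K" "z \<in> h -` K" for y z
      using that cK isometry_midpoint[OF h'] by (simp add: midpoint_def convex_alt scaleR_add_right
          convexD[OF cK, of "h y" "h z" "1/2" "1/2", simplified])
    ultimately have "closed (h -` K)" "convex (h -` K)"
      using closed_midpoint_convex by blast+
    moreover have "(\<lambda>k. k s0) ` H \<subseteq> h -` K"
    proof clarify
      fix k assume "k \<in> H"
      then have "h \<circ> k \<in> H" by (rule isom_subgroup_comp[OF H h])
      then show "k s0 \<in> h -` K" using orbit_K by fastforce
    qed
    ultimately show "h x \<in> K" using K_min x by blast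
  qed
  \<comment> \<open>Zorn's lemma yields maximal elements, so it is applied to the complements.\<close>
  have "\<exists>D\<in>{- C | C. good C}. \<forall>E\<in>{- C | C. good C}. D \<subseteq> E \<longrightarrow> E = D"
  proof (rule subset_Zorn_nonempty)
    show "{- C | C. good C} \<noteq> {}" using \<open>good K\<close> by blast
    fix \<C> assume ne: "\<C> \<noteq> {}" and chain: "subset.chain {- C | C. good C} \<C>"
    have good_compl: "good (- D)" if "D \<in> \<C>" for D
      using chain that unfolding subset.chain_def by force
    define B where "B = \<Inter>(uminus ` \<C>)"
    obtain T0 where T0: "T0 \<in> uminus ` \<C>" using ne by auto
    have good_T: "good T" if "T \<in> uminus ` \<C>" for T using that good_compl by auto
    have "T0 \<inter> B \<noteq> {}"
      unfolding B_def
    proof (rule compact_imp_fip)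
      show "compact T0" "\<And>T. T \<in> uminus ` \<C> \<Longrightarrow> closed T"
        using good_T T0 compact_imp_closed unfolding good_def by blast+
      fix \<F> assume \<F>: "finite \<F>" "\<F> \<subseteq> uminus ` \<C>"
      obtain M where M: "M \<in> insert T0 \<F>" "\<And>T. T \<in> insert T0 \<F> \<Longrightarrow> T \<subseteq> M \<Longrightarrow> M = T"
        using finite_has_minimal[of "insert T0 \<F>"] \<F>(1) by blast
      have MU: "M \<in> uminus ` \<C>" using M(1) T0 \<F>(2) by blast
      have "M \<subseteq> T" if T: "T \<in> insert T0 \<F>" for T
      proof -
        have "T \<in> uminus ` \<C>" using T T0 \<F>(2) by blast
        then have "T \<subseteq> M \<or> M \<subseteq> T" using MU chain unfolding subset.chain_def by blast
        then show ?thesis using M(2)[OF T] by blast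
      qed
      then have "M \<subseteq> T0 \<inter> \<Inter>\<F>" by blast
      moreover have "M \<noteq> {}" using good_T[OF MU] by (simp add: good_def)
      ultimately show "T0 \<inter> \<Inter>\<F> \<noteq> {}" by blast
    qed
    then have "B \<noteq> {}" by blast
    moreover have "compact B"
    proof -
      have "closed B" unfolding B_def
        using good_T compact_imp_closed unfolding good_def by (intro closed_Inter) blast
      moreover have "compact T0" using good_T[OF T0] by (simp add: good_def)
      moreover have "B = T0 \<inter> B" unfolding B_def using T0 by blast
      ultimately show ?thesis using compact_Int_closed by metis
    qed
    moreover have "convex B" unfolding B_def
      using good_T unfolding good_def by (intro convex_Inter) blast
    moreover have "B \<subseteq> S" using ne good_compl unfolding good_def B_def by blast
    moreover have "\<forall>h\<in>H. \<forall>x\<in>B. h x \<in> B" using good_compl unfolding good_def B_def by blast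
    ultimately have "good B" unfolding good_def by blast
    moreover have "\<Union>\<C> = - B" unfolding B_def by auto
    ultimately show "\<Union>\<C> \<in> {- C | C. good C}" by blast
  qed
  then obtain C where C: "good C" and "\<forall>E\<in>{- C | C. good C}. - C \<subseteq> E \<longrightarrow> E = - C" by blast
  then have C_min: "D = C" if "good D" "D \<subseteq> C" for D using that by blast
  have single: "a = b" if ab: "a \<in> C" "b \<in> C" for a b
  proof (rule ccontr)
    assume "a \<noteq> b"
    then obtain x r u v where x: "x \<in> C" "\<And>y. y \<in> C \<Longrightarrow> dist x y \<le> r"
      and uv: "u \<in> C" "v \<in> C" "r < dist u v"
      using compact_convex_normal_structure[of C a b] C ab unfolding good_def by metis
    define D where "D = C \<inter> (\<Inter>y\<in>C. cball y r)"
    have "h z \<in> D" if h: "h \<in> H" and z: "z \<in> D" for h z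
    proof -
      obtain k where k: "k \<in> H" "\<And>x. h (k x) = x" "\<And>x. k (h x) = x"
      using isom_subgroup_inverse[OF H h] by blast
      have "dist y (h z) \<le> r" if "y \<in> C" for y
      proof -
        have "dist y (h z) = dist (k y) z"
          using isom_groupD(2)[OF H.mem_carrier[OF h], of "k y" z] k(2) by simp
        moreover have "k y \<in> C" using C k(1) that unfolding good_def by blast
        ultimately show ?thesis using z by (auto simp: D_def)
      qed
      moreover have "h z \<in> C" using C h z unfolding good_def D_def by blast
      ultimately show ?thesis by (simp add: D_def)
    qed
    moreover have "x \<in> D" using x by (simp add: D_def dist_commute)
    moreover have "compact D" "convex D" "D \<subseteq> S"
      using C unfolding good_def D_def
      by (auto intro!: compact_Int_closed closed_INT convex_Int convex_INT)
    ultimately have "D = C" by (intro C_min) (auto simp: good_def D_def)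
    then have "u \<in> D" using uv by simp
    then show False using uv by (auto simp: D_def dist_commute)
  qed
  obtain p where "p \<in> C" using C unfolding good_def by auto
  moreover have "h p = p" if "h \<in> H" for h
    using single C that \<open>p \<in> C\<close> unfolding good_def by blast
  ultimately show ?thesis using C unfolding good_def by blast
qed

lemma banach_midpoint_space: "midpoint_space (midpoint :: 'b::banach \<Rightarrow> 'b \<Rightarrow> 'b)"
proof
  fix x y z :: 'b
  show "midpoint x x = x" "midpoint x y = midpoint y x" by (simp_all add: midpoint_sym)
  have "midpoint x z - midpoint y z = (1/2) *\<^sub>R (x - y)"
    by (simp add: midpoint_def algebra_simps)
  then show "dist (midpoint x z) (midpoint y z) \<le> dist x y / 2" by (simp add: dist_norm)
next
  fix H and S :: "'b set"
  assume "subgroup H isom_group" "\<And>x::'b. compact ((\<lambda>h. h x) ` H)" "closed S" "S \<noteq> {}"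
    "\<And>x y. x \<in> S \<Longrightarrow> y \<in> S \<Longrightarrow> midpoint x y \<in> S"
    "\<And>h x. h \<in> H \<Longrightarrow> x \<in> S \<Longrightarrow> h x \<in> S"
  then show "\<exists>p\<in>S. \<forall>h\<in>H. h p = p" by (rule banach_compact_group_fixed_point)
qed (rule isometry_midpoint)

section \<open>Mass transport for actions of unimodular groups\<close>

locale unimodular_action = group_action G V \<alpha>
  for G :: "('g, 'e) monoid_scheme" (structure) and V :: "'v set" and \<alpha> +
  fixes T :: "'g topology" and \<mu> :: "'g measure" and R :: "'v set"
  assumes haar: "left_haar_measure G T \<mu>"
    and right_invariant: "\<And>g A. g \<in> carrier G \<Longrightarrow> A \<in> sets \<mu> \<Longrightarrow> emeasure \<mu> (A #> g) = emeasure \<mu> A"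
    and topspace_eq: "topspace T = carrier G"
    and transporter_open: "\<And>u v. u \<in> V \<Longrightarrow> v \<in> V \<Longrightarrow> openin T {g \<in> carrier G. \<alpha> g u = v}"
    and transporter_compact: "\<And>u v. u \<in> V \<Longrightarrow> v \<in> V \<Longrightarrow> compactin T {g \<in> carrier G. \<alpha> g u = v}"
    and finite_reps: "finite R" and reps_subset: "R \<subseteq> V"
    and reps_unique: "\<And>v. v \<in> V \<Longrightarrow> \<exists>!u. u \<in> R \<and> v \<in> orbit G \<alpha> u"
begin

sublocale group G
  using group_hom group_hom.axioms(1) by blast

definition transporter :: "'v \<Rightarrow> 'v \<Rightarrow> 'g set" where
  "transporter u v = {g \<in> carrier G. \<alpha> g u = v}"

definition stab_mass :: "'v \<Rightarrow> real" where
  "stab_mass u = measure \<mu> (transporter u u)"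

lemma act_closed: "g \<in> carrier G \<Longrightarrow> u \<in> V \<Longrightarrow> \<alpha> g u \<in> V"
  using element_image by blast

lemma act_inv: "g \<in> carrier G \<Longrightarrow> u \<in> V \<Longrightarrow> \<alpha> (inv g) (\<alpha> g u) = u"
  using orbit_sym_aux by blast

lemma act_inv': "g \<in> carrier G \<Longrightarrow> u \<in> V \<Longrightarrow> \<alpha> g (\<alpha> (inv g) u) = u"
  using act_inv[of "inv g" u] by simp

lemma orbit_in: "u \<in> V \<Longrightarrow> v \<in> orbit G \<alpha> u \<Longrightarrow> v \<in> V"
  unfolding orbit_def using act_closed by blast

lemma sets_transporter: "u \<in> V \<Longrightarrow> v \<in> V \<Longrightarrow> transporter u v \<in> sets \<mu>"
  using haar transporter_open[of u v]
  unfolding left_haar_measure_def radon_measure_def transporter_def by (auto intro: sigma_sets.Basic)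

lemma emeasure_transporter_finite: "u \<in> V \<Longrightarrow> v \<in> V \<Longrightarrow> emeasure \<mu> (transporter u v) < \<infinity>"
  using haar transporter_compact[of u v] sets_transporter[of u v]
  unfolding left_haar_measure_def radon_measure_def transporter_def by blast

lemma transporter_left_coset:
  assumes "u \<in> V" "h \<in> carrier G"
  shows "transporter u (\<alpha> h u) = h <# transporter u u"
proof (intro Set.set_eqI iffI)
  fix g assume "g \<in> transporter u (\<alpha> h u)"
  then have g: "g \<in> carrier G" "\<alpha> g u = \<alpha> h u" by (auto simp: transporter_def)
  then have "inv h \<otimes> g \<in> transporter u u"
    using assms by (simp add: transporter_def composition_rule act_inv)
  moreover have "g = h \<otimes> (inv h \<otimes> g)" using g assms by (simp add: m_assoc[symmetric])
  ultimately show "g \<in> h <# transporter u u" unfolding l_coset_def by blast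
next
  fix g assume "g \<in> h <# transporter u u"
  then show "g \<in> transporter u (\<alpha> h u)"
    using assms by (auto simp: l_coset_def transporter_def composition_rule)
qed

lemma transporter_right_coset:
  assumes "u \<in> V" "h \<in> carrier G"
  shows "transporter (\<alpha> h u) u = transporter u u #> inv h"
proof (intro Set.set_eqI iffI)
  fix g assume "g \<in> transporter (\<alpha> h u) u"
  then have g: "g \<in> carrier G" "\<alpha> g (\<alpha> h u) = u" by (auto simp: transporter_def)
  then have "g \<otimes> h \<in> transporter u u"
    using assms by (simp add: transporter_def composition_rule)
  moreover have "g = (g \<otimes> h) \<otimes> inv h" using g assms by (simp add: m_assoc)
  ultimately show "g \<in> transporter u u #> inv h" unfolding r_coset_def by blast
next
  fix g assume "g \<in> transporter u u #> inv h"
  then show "g \<in> transporter (\<alpha> h u) u"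
    using assms by (auto simp: r_coset_def transporter_def composition_rule act_inv act_closed)
qed

lemma measure_transporter:
  assumes "u \<in> V" "v \<in> orbit G \<alpha> u"
  shows "measure \<mu> (transporter u v) = stab_mass u" "measure \<mu> (transporter v u) = stab_mass u"
proof -
  obtain h where h: "h \<in> carrier G" "v = \<alpha> h u" using assms(2) by (auto simp: orbit_def)
  have "emeasure \<mu> (transporter u v) = emeasure \<mu> (transporter u u)"
    using haar sets_transporter[OF assms(1,1)] h(1)
    unfolding left_haar_measure_def h(2) transporter_left_coset[OF assms(1) h(1)] by blast
  moreover have "emeasure \<mu> (transporter v u) = emeasure \<mu> (transporter u u)"
    using right_invariant[of "inv h"] sets_transporter[OF assms(1,1)] h(1)
    unfolding h(2) transporter_right_coset[OF assms(1) h(1)] by simp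
  ultimately show "measure \<mu> (transporter u v) = stab_mass u"
    "measure \<mu> (transporter v u) = stab_mass u"
    by (simp_all add: stab_mass_def measure_def)
qed

lemma stab_mass_nonneg: "0 \<le> stab_mass u"
  by (simp add: stab_mass_def)

text \<open>
  If a stabiliser were a null set, then so would be its translates, which are open and cover the
  group; hence all compact sets would be null sets, and by inner regularity the whole group.
\<close>

lemma stab_mass_pos:
  assumes u: "u \<in> V"
  shows "stab_mass u > 0"
proof (rule ccontr)
  assume "\<not> ?thesis"
  then have "stab_mass u = 0" by (simp add: stab_mass_def not_less order_antisym)
  then have null: "emeasure \<mu> (transporter u v) = 0" if "v \<in> orbit G \<alpha> u" for v
    using measure_transporter(1)[OF u that] emeasure_transporter_finite[OF u orbit_in[OF u that]]
    by (simp add: emeasure_eq_ennreal_measure)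
  have compact_null: "emeasure \<mu> K = 0" if K: "compactin T K" for K
  proof -
    have "K \<subseteq> topspace T" using K by (rule compactin_subset_topspace)
    then have "K \<subseteq> \<Union>(transporter u ` orbit G \<alpha> u)"
      unfolding topspace_eq orbit_def transporter_def by blast
    moreover have "\<And>U. U \<in> transporter u ` orbit G \<alpha> u \<Longrightarrow> openin T U"
      using transporter_open[OF u orbit_in[OF u]] unfolding transporter_def by blast
    ultimately obtain \<F> where \<F>: "finite \<F>" "\<F> \<subseteq> transporter u ` orbit G \<alpha> u" "K \<subseteq> \<Union>\<F>"
      using K unfolding compactin_def by meson
    have "A \<in> null_sets \<mu>" if "A \<in> \<F>" for A
      using that \<F>(2) null sets_transporter[OF u orbit_in[OF u]] by (auto intro: null_setsI)
    then have "\<Union>\<F> \<in> null_sets \<mu>"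
      using null_sets_UN'[of \<F> "\<lambda>A. A" \<mu>] countable_finite[OF \<F>(1)] by simp
    then show ?thesis
      using emeasure_mono[OF \<F>(3), of \<mu>] by (auto simp: null_sets_def)
  qed
  have "emeasure \<mu> (space \<mu>) = (SUP K\<in>{K. compactin T K \<and> K \<subseteq> space \<mu>}. emeasure \<mu> K)"
    using haar openin_topspace[of T] unfolding left_haar_measure_def radon_measure_def by metis
  also have "\<dots> \<le> 0" using compact_null by (intro SUP_least) auto
  finally show False using haar unfolding left_haar_measure_def by simp
qed

text \<open>
  With \<open>F u v\<close> read as \<open>0\<close> unless \<open>v\<close> is in \<open>N u\<close>, both sides compute the integral over \<open>g\<close> of
  \<open>F u (\<alpha> g w)\<close>. On the left the group is cut into the cosets \<open>transporter w v\<close>, on the right, where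
  the integrand is \<open>F (\<alpha> (inv g) u) w\<close>, into the cosets \<open>transporter u' u\<close>. The former all have the
  mass of the stabiliser of \<open>w\<close> because the measure is left invariant, the latter the mass of
  the stabiliser of \<open>u\<close> because it is right invariant.
\<close>

lemma mass_transport_orbits:
  fixes F :: "'v \<Rightarrow> 'v \<Rightarrow> real"
  assumes F: "\<And>g u v. g \<in> carrier G \<Longrightarrow> u \<in> V \<Longrightarrow> v \<in> N u \<Longrightarrow> F (\<alpha> g u) (\<alpha> g v) = F u v"
    and N: "\<And>u. u \<in> V \<Longrightarrow> finite (N u)" "\<And>u. u \<in> V \<Longrightarrow> N u \<subseteq> V"
    and N_sym: "\<And>u v. u \<in> V \<Longrightarrow> v \<in> N u \<Longrightarrow> u \<in> N v"
    and N_inv: "\<And>g u v. g \<in> carrier G \<Longrightarrow> u \<in> V \<Longrightarrow> v \<in> N u \<Longrightarrow> \<alpha> g v \<in> N (\<alpha> g u)"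
    and u: "u \<in> V" and w: "w \<in> V"
  shows "stab_mass w * (\<Sum>v\<in>N u \<inter> orbit G \<alpha> w. F u v) =
         stab_mass u * (\<Sum>u'\<in>N w \<inter> orbit G \<alpha> u. F u' w)"
proof -
  define A where "A v u' = transporter w v \<inter> transporter u' u" for v u'
  let ?I = "N u \<inter> orbit G \<alpha> w" and ?J = "N w \<inter> orbit G \<alpha> u"
  have fin: "finite ?I" "finite ?J" using N u w by auto
  have IV: "v \<in> V" if "v \<in> ?I" for v using that N(2)[OF u] by blast
  have JV: "v \<in> V" if "v \<in> ?J" for v using that N(2)[OF w] by blast
  have A_sets: "A v u' \<in> sets \<mu>" if "v \<in> ?I" "u' \<in> ?J" for v u'
    unfolding A_def using that IV JV u w by (intro sets.Int sets_transporter)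
  have A_fin: "emeasure \<mu> (A v u') \<noteq> \<infinity>" if "v \<in> ?I" "u' \<in> ?J" for v u'
  proof -
    have "emeasure \<mu> (A v u') \<le> emeasure \<mu> (transporter w v)"
      unfolding A_def using IV that w by (intro emeasure_mono sets_transporter) auto
    then show ?thesis using emeasure_transporter_finite[OF w IV[OF that(1)]] by auto
  qed
  have sum_J: "measure \<mu> (transporter w v) = (\<Sum>u'\<in>?J. measure \<mu> (A v u'))" if v: "v \<in> ?I" for v
  proof -
    have "transporter w v = (\<Union>u'\<in>?J. A v u')"
    proof
      show "transporter w v \<subseteq> (\<Union>u'\<in>?J. A v u')"
      proof
        fix g assume "g \<in> transporter w v"
        then have g: "g \<in> carrier G" "\<alpha> g w = v" by (auto simp: transporter_def)
        let ?u' = "\<alpha> (inv g) u"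
        have "\<alpha> (inv g) v = w" using g w act_inv by blast
        then have "?u' \<in> N w"
          using N_inv[of "inv g" v u] N_sym[OF u] v IV[OF v] g(1) by auto
        moreover have "?u' \<in> orbit G \<alpha> u" using g(1) by (auto simp: orbit_def)
        moreover have "g \<in> A v ?u'" using g act_inv'[OF g(1) u] by (simp add: A_def transporter_def)
        ultimately show "g \<in> (\<Union>u'\<in>?J. A v u')" by blast
      qed
    qed (auto simp: A_def)
    moreover have "disjoint_family_on (A v) ?J"
      unfolding disjoint_family_on_def A_def transporter_def
      using JV act_inv by (auto, metis)
    ultimately show ?thesis
      using measure_finite_Union[OF fin(2), of "A v" \<mu>] A_sets A_fin v by auto
  qed
  have sum_I: "measure \<mu> (transporter u' u) = (\<Sum>v\<in>?I. measure \<mu> (A v u'))" if u': "u' \<in> ?J" for u'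
  proof -
    have "transporter u' u = (\<Union>v\<in>?I. A v u')"
    proof
      show "transporter u' u \<subseteq> (\<Union>v\<in>?I. A v u')"
      proof
        fix g assume "g \<in> transporter u' u"
        then have g: "g \<in> carrier G" "\<alpha> g u' = u" by (auto simp: transporter_def)
        have "\<alpha> g w \<in> N u"
          using N_inv[of g u' w] N_sym[OF w] u' JV[OF u'] g by auto
        moreover have "\<alpha> g w \<in> orbit G \<alpha> w" using g(1) by (auto simp: orbit_def)
        moreover have "g \<in> A (\<alpha> g w) u'" using g by (simp add: A_def transporter_def)
        ultimately show "g \<in> (\<Union>v\<in>?I. A v u')" by blast
      qed
    qed (auto simp: A_def)
    moreover have "disjoint_family_on (\<lambda>v. A v u') ?I"
      unfolding disjoint_family_on_def A_def transporter_def by auto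
    ultimately show ?thesis
      using measure_finite_Union[OF fin(1), of "\<lambda>v. A v u'" \<mu>] A_sets A_fin u' by auto
  qed
  have "stab_mass w * (\<Sum>v\<in>?I. F u v) = (\<Sum>v\<in>?I. F u v * measure \<mu> (transporter w v))"
    unfolding sum_distrib_left using measure_transporter(1)[OF w] by (intro sum.cong) auto
  also have "\<dots> = (\<Sum>v\<in>?I. \<Sum>u'\<in>?J. F u v * measure \<mu> (A v u'))"
    using sum_J by (intro sum.cong) (auto simp: sum_distrib_left)
  also have "\<dots> = (\<Sum>v\<in>?I. \<Sum>u'\<in>?J. F u' w * measure \<mu> (A v u'))"
  proof (intro sum.cong refl)
    fix v u' assume "v \<in> ?I" "u' \<in> ?J"
    show "F u v * measure \<mu> (A v u') = F u' w * measure \<mu> (A v u')"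
    proof (cases "A v u' = {}")
      case False
      then obtain g where "g \<in> carrier G" "\<alpha> g w = v" "\<alpha> g u' = u"
        by (auto simp: A_def transporter_def)
      then show ?thesis using F[of g u' w] JV[OF \<open>u' \<in> ?J\<close>] N_sym[OF w] \<open>u' \<in> ?J\<close> by simp
    qed simp
  qed
  also have "\<dots> = (\<Sum>u'\<in>?J. \<Sum>v\<in>?I. F u' w * measure \<mu> (A v u'))" by (rule sum.swap)
  also have "\<dots> = (\<Sum>u'\<in>?J. F u' w * measure \<mu> (transporter u' u))"
    using sum_I by (intro sum.cong) (auto simp: sum_distrib_left)
  also have "\<dots> = stab_mass u * (\<Sum>u'\<in>?J. F u' w)"
    unfolding sum_distrib_left using measure_transporter(2)[OF u] by (intro sum.cong) auto
  finally show ?thesis .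
qed

text \<open>
  Each orbit gets the inverse mass of a stabiliser as its weight, which is one over the order of
  the stabiliser if the group is discrete. With these weights the total mass sent out equals the
  total mass received.
\<close>

lemma mass_transport:
  fixes F :: "'v \<Rightarrow> 'v \<Rightarrow> real"
  assumes F: "\<And>g u v. g \<in> carrier G \<Longrightarrow> u \<in> V \<Longrightarrow> v \<in> N u \<Longrightarrow> F (\<alpha> g u) (\<alpha> g v) = F u v"
    and N: "\<And>u. u \<in> V \<Longrightarrow> finite (N u)" "\<And>u. u \<in> V \<Longrightarrow> N u \<subseteq> V"
    and N_sym: "\<And>u v. u \<in> V \<Longrightarrow> v \<in> N u \<Longrightarrow> u \<in> N v"
    and N_inv: "\<And>g u v. g \<in> carrier G \<Longrightarrow> u \<in> V \<Longrightarrow> v \<in> N u \<Longrightarrow> \<alpha> g v \<in> N (\<alpha> g u)"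
  shows "(\<Sum>u\<in>R. (\<Sum>v\<in>N u. F u v) / stab_mass u) = (\<Sum>u\<in>R. (\<Sum>v\<in>N u. F v u) / stab_mass u)"
proof -
  have split: "(\<Sum>v\<in>N u. h v) = (\<Sum>w\<in>R. \<Sum>v\<in>N u \<inter> orbit G \<alpha> w. h v)" if u: "u \<in> R"
    for u and h :: "'v \<Rightarrow> real"
  proof -
    have uV: "u \<in> V" using u reps_subset by blast
    have "N u = (\<Union>w\<in>R. N u \<inter> orbit G \<alpha> w)" using N(2)[OF uV] reps_unique by blast
    then have "(\<Sum>v\<in>N u. h v) = (\<Sum>v\<in>(\<Union>w\<in>R. N u \<inter> orbit G \<alpha> w). h v)" by simp
    also have "\<dots> = (\<Sum>w\<in>R. \<Sum>v\<in>N u \<inter> orbit G \<alpha> w. h v)"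
      using N[OF uV] reps_unique finite_reps by (intro sum.UNION_disjoint) blast+
    finally show ?thesis .
  qed
  have "(\<Sum>u\<in>R. (\<Sum>v\<in>N u. F u v) / stab_mass u)
      = (\<Sum>u\<in>R. \<Sum>w\<in>R. (\<Sum>v\<in>N u \<inter> orbit G \<alpha> w. F u v) / stab_mass u)"
    by (intro sum.cong refl) (simp add: split sum_divide_distrib)
  also have "\<dots> = (\<Sum>u\<in>R. \<Sum>w\<in>R. (\<Sum>v\<in>N w \<inter> orbit G \<alpha> u. F v w) / stab_mass w)"
  proof (intro sum.cong refl)
    fix u w assume "u \<in> R" "w \<in> R"
    then have uw: "u \<in> V" "w \<in> V" using reps_subset by auto
    from mass_transport_orbits[of N F, OF F N N_sym N_inv uw] stab_mass_pos[OF uw(1)]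
      stab_mass_pos[OF uw(2)]
    show "(\<Sum>v\<in>N u \<inter> orbit G \<alpha> w. F u v) / stab_mass u
        = (\<Sum>v\<in>N w \<inter> orbit G \<alpha> u. F v w) / stab_mass w"
      by (simp add: divide_simps mult.commute)
  qed
  also have "\<dots> = (\<Sum>w\<in>R. \<Sum>u\<in>R. (\<Sum>v\<in>N w \<inter> orbit G \<alpha> u. F v w) / stab_mass w)"
    by (rule sum.swap)
  also have "\<dots> = (\<Sum>w\<in>R. (\<Sum>v\<in>N w. F v w) / stab_mass w)"
    by (intro sum.cong refl) (simp add: split[of _ "\<lambda>v. F v _"] sum_divide_distrib)
  finally show ?thesis .
qed

end

section \<open>Weighted complexes\<close>

locale weighted_complex = unimodular_action G "\<Union>X" \<alpha> T \<mu> R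
  for X :: "'v set set" and G :: "('g, 'e) monoid_scheme" (structure) and \<alpha> T \<mu> R +
  fixes m :: "'v list \<Rightarrow> real" and C :: real
  assumes cplx: "simplicial_cplx X" and finite_links: "vertex_links_finite X"
    and simplex_image: "\<And>g \<sigma>. g \<in> carrier G \<Longrightarrow> \<sigma> \<in> X \<Longrightarrow> \<alpha> g ` \<sigma> \<in> X"
    and weight: "weight X G \<alpha> m C"
begin

definition nbrs :: "'v \<Rightarrow> 'v set" where
  "nbrs u = {v. v \<noteq> u \<and> {u, v} \<in> X}"

definition opposite :: "'v \<Rightarrow> 'v \<Rightarrow> 'v set" where
  "opposite u v = {w. distinct [u, v, w] \<and> {u, v, w} \<in> X}"

lemma face: "\<sigma> \<in> X \<Longrightarrow> \<tau> \<subseteq> \<sigma> \<Longrightarrow> \<tau> \<noteq> {} \<Longrightarrow> \<tau> \<in> X"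
  using cplx unfolding simplicial_cplx_def by blast

lemma nbrs_vertex: "v \<in> nbrs u \<Longrightarrow> u \<in> \<Union>X" "v \<in> nbrs u \<Longrightarrow> v \<in> \<Union>X"
  by (auto simp: nbrs_def)

lemma nbrs_sym: "v \<in> nbrs u \<Longrightarrow> u \<in> nbrs v"
  by (auto simp: nbrs_def insert_commute)

lemma opposite_nbrs: "w \<in> opposite u v \<Longrightarrow> v \<in> nbrs u" "w \<in> opposite u v \<Longrightarrow> w \<in> nbrs u"
  unfolding opposite_def nbrs_def by (auto elim: face)

lemma opposite_sym: "w \<in> opposite u v \<longleftrightarrow> v \<in> opposite u w" "w \<in> opposite u v \<longleftrightarrow> w \<in> opposite v u"
  by (auto simp: opposite_def insert_commute)

lemma finite_nbrs:
  assumes "u \<in> \<Union>X"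
  shows "finite (nbrs u)"
proof (rule inj_on_finite)
  show "inj_on (\<lambda>v. {v}) (nbrs u)" by simp
  show "(\<lambda>v. {v}) ` nbrs u \<subseteq> cplx_link X {u}" by (auto simp: nbrs_def cplx_link_def)
  show "finite (cplx_link X {u})" using finite_links assms unfolding vertex_links_finite_def by blast
qed

lemma finite_opposite: "u \<in> \<Union>X \<Longrightarrow> finite (opposite u v)"
  by (rule finite_subset[OF _ finite_nbrs]) (auto intro: opposite_nbrs)

lemma act_eq_iff: "g \<in> carrier G \<Longrightarrow> u \<in> \<Union>X \<Longrightarrow> v \<in> \<Union>X \<Longrightarrow> \<alpha> g u = \<alpha> g v \<longleftrightarrow> u = v"
  using inj_prop inj_on_eq_iff by metis

lemma act_nbrs:
  assumes "g \<in> carrier G" "v \<in> nbrs u"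
  shows "\<alpha> g v \<in> nbrs (\<alpha> g u)"
  using simplex_image[OF assms(1), of "{u, v}"] act_eq_iff[OF assms(1), of v u] nbrs_vertex[OF assms(2)]
    assms(2) by (simp add: nbrs_def)

lemma act_opposite:
  assumes "g \<in> carrier G" "w \<in> opposite u v"
  shows "\<alpha> g w \<in> opposite (\<alpha> g u) (\<alpha> g v)"
proof -
  note nbrs_vertex[OF opposite_nbrs(1)[OF assms(2)]] nbrs_vertex[OF opposite_nbrs(2)[OF assms(2)]]
  then show ?thesis
    using simplex_image[OF assms(1), of "{u, v, w}"] act_eq_iff[OF assms(1)] assms(2)
    by (simp add: opposite_def)
qed

lemma opposite_act:
  assumes g: "g \<in> carrier G" and v: "v \<in> nbrs u"
  shows "opposite (\<alpha> g u) (\<alpha> g v) = \<alpha> g ` opposite u v"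
proof
  show "opposite (\<alpha> g u) (\<alpha> g v) \<subseteq> \<alpha> g ` opposite u v"
  proof
    fix w assume w: "w \<in> opposite (\<alpha> g u) (\<alpha> g v)"
    have "\<alpha> (inv g) w \<in> opposite u v"
      using act_opposite[OF inv_closed[OF g] w] act_inv[OF g] nbrs_vertex[OF v] by simp
    moreover have "\<alpha> g (\<alpha> (inv g) w) = w"
      using act_inv'[OF g] nbrs_vertex(2)[OF opposite_nbrs(2)[OF w]] by blast
    ultimately show "w \<in> \<alpha> g ` opposite u v" by (metis image_eqI)
  qed
qed (use act_opposite[OF g] in blast)

lemma ordered_edge: "v \<in> nbrs u \<Longrightarrow> [u, v] \<in> ordered_simplices X 1"
  by (auto simp: nbrs_def ordered_simplices_def)

lemma ordered_triangle: "w \<in> opposite u v \<Longrightarrow> [u, v, w] \<in> ordered_simplices X 2"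
  by (auto simp: opposite_def ordered_simplices_def)

lemma weight_perm:
  "\<sigma> \<in> ordered_simplices X 1 \<union> ordered_simplices X 2 \<Longrightarrow> mset \<sigma>' = mset \<sigma> \<Longrightarrow> m \<sigma>' = m \<sigma>"
  using weight unfolding weight_def by blast

lemma weight_pos: "\<sigma> \<in> ordered_simplices X 1 \<union> ordered_simplices X 2 \<Longrightarrow> m \<sigma> > 0"
  using weight unfolding weight_def by blast

lemma weight_act:
  "\<sigma> \<in> ordered_simplices X 1 \<union> ordered_simplices X 2 \<Longrightarrow> g \<in> carrier G \<Longrightarrow> m (map (\<alpha> g) \<sigma>) = m \<sigma>"
  using weight unfolding weight_def by blast

lemma weight_edge:
  assumes "v \<in> nbrs u"
  shows "m [u, v] > 0" "m [v, u] = m [u, v]" "g \<in> carrier G \<Longrightarrow> m [\<alpha> g u, \<alpha> g v] = m [u, v]"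
  using weight_pos[of "[u, v]"] weight_perm[of "[u, v]" "[v, u]"] weight_act[of "[u, v]" g]
    ordered_edge[OF assms] by (simp_all add: add_mset_commute)

lemma weight_triangle:
  assumes "w \<in> opposite u v"
  shows "m [u, v, w] > 0" "m [u, w, v] = m [u, v, w]" "m [v, u, w] = m [u, v, w]"
    "g \<in> carrier G \<Longrightarrow> m [\<alpha> g u, \<alpha> g v, \<alpha> g w] = m [u, v, w]"
  using weight_pos[of "[u, v, w]"] weight_perm[of "[u, v, w]" "[u, w, v]"]
    weight_perm[of "[u, v, w]" "[v, u, w]"] weight_act[of "[u, v, w]" g]
    ordered_triangle[OF assms] by (simp_all add: add_mset_commute)

text \<open>
  The definition of a weight sums over ordered triangles; the factor \<open>fact 3\<close> in it counts the
  orderings of each triangle.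
\<close>

lemma weight_sum_opposite:
  assumes v: "v \<in> nbrs u"
  shows "(\<Sum>w\<in>opposite u v. m [u, v, w]) = C * m [u, v]"
proof -
  have fin: "finite (opposite u v)" using finite_opposite nbrs_vertex(1)[OF v] by blast
  have eq: "{\<sigma> \<in> ordered_simplices X 2. set [u, v] \<subseteq> set \<sigma>}
      = (\<Union>w\<in>opposite u v. permutations_of_set {u, v, w})"
  proof (intro Set.set_eqI iffI)
    fix \<sigma> assume "\<sigma> \<in> {\<sigma> \<in> ordered_simplices X 2. set [u, v] \<subseteq> set \<sigma>}"
    then have \<sigma>: "length \<sigma> = 3" "distinct \<sigma>" "set \<sigma> \<in> X" "u \<in> set \<sigma>" "v \<in> set \<sigma>"
      by (auto simp: ordered_simplices_def)
    have "card {u, v} = 2" using v by (auto simp: nbrs_def card_2_iff)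
    then have "card (set \<sigma> - {u, v}) = 1"
      using \<sigma> distinct_card[OF \<sigma>(2)] by (simp add: card_Diff_subset)
    then obtain w where "set \<sigma> - {u, v} = {w}" by (meson card_1_singletonE)
    then have "set \<sigma> = {u, v, w}" "w \<noteq> u" "w \<noteq> v" using \<sigma> by blast+
    then show "\<sigma> \<in> (\<Union>w\<in>opposite u v. permutations_of_set {u, v, w})"
      using \<sigma> v by (auto simp: permutations_of_set_def opposite_def nbrs_def)
  next
    fix \<sigma> assume "\<sigma> \<in> (\<Union>w\<in>opposite u v. permutations_of_set {u, v, w})"
    then obtain w where w: "w \<in> opposite u v" "set \<sigma> = {u, v, w}" "distinct \<sigma>"
      by (auto simp: permutations_of_set_def)
    have "length \<sigma> = 3" using distinct_card[OF w(3)] w(1,2) by (simp add: opposite_def)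
    then show "\<sigma> \<in> {\<sigma> \<in> ordered_simplices X 2. set [u, v] \<subseteq> set \<sigma>}"
      using w by (auto simp: ordered_simplices_def opposite_def)
  qed
  have "fact 3 * C * m [u, v] = (\<Sum>\<sigma>\<in>(\<Union>w\<in>opposite u v. permutations_of_set {u, v, w}). m \<sigma>)"
  proof -
    have "\<forall>\<tau>\<in>ordered_simplices X 1.
        (\<Sum>\<sigma> | \<sigma> \<in> ordered_simplices X 2 \<and> set \<tau> \<subseteq> set \<sigma>. m \<sigma>) = fact 3 * C * m \<tau>"
      using weight unfolding weight_def by (rule conjunct2)
    from bspec[OF this ordered_edge[OF v]] show ?thesis unfolding eq by (rule sym)
  qed
  also have "\<dots> = (\<Sum>w\<in>opposite u v. \<Sum>\<sigma>\<in>permutations_of_set {u, v, w}. m \<sigma>)"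
  proof (rule sum.UNION_disjoint[OF fin])
    show "\<forall>w\<in>opposite u v. \<forall>w'\<in>opposite u v. w \<noteq> w' \<longrightarrow>
        permutations_of_set {u, v, w} \<inter> permutations_of_set {u, v, w'} = {}"
    proof (intro ballI impI)
      fix w w' assume "w \<in> opposite u v" "w' \<in> opposite u v" "w \<noteq> w'"
      then have "{u, v, w} \<noteq> {u, v, w'}" by (auto simp: opposite_def)
      then show "permutations_of_set {u, v, w} \<inter> permutations_of_set {u, v, w'} = {}"
        unfolding permutations_of_set_def by blast
    qed
  qed simp
  also have "\<dots> = (\<Sum>w\<in>opposite u v. fact 3 * m [u, v, w])"
  proof (intro sum.cong refl)
    fix w assume w: "w \<in> opposite u v"
    have "(\<Sum>\<sigma>\<in>permutations_of_set {u, v, w}. m \<sigma>) = (\<Sum>\<sigma>\<in>permutations_of_set {u, v, w}. m [u, v, w])"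
    proof (intro sum.cong refl weight_perm)
      fix \<sigma> assume "\<sigma> \<in> permutations_of_set {u, v, w}"
      then have "set \<sigma> = set [u, v, w]" "distinct \<sigma>" by (auto simp: permutations_of_set_def)
      then show "mset \<sigma> = mset [u, v, w]"
        using w set_eq_iff_mset_eq_distinct[of \<sigma> "[u, v, w]"] by (simp add: opposite_def)
    qed (use ordered_triangle[OF w] in blast)
    also have "card {u, v, w} = 3" using w by (simp add: opposite_def)
    then have "(\<Sum>\<sigma>\<in>permutations_of_set {u, v, w}. m [u, v, w]) = fact 3 * m [u, v, w]"
      by simp
    finally show "(\<Sum>\<sigma>\<in>permutations_of_set {u, v, w}. m \<sigma>) = fact 3 * m [u, v, w]" .
  qed
  finally show ?thesis by (simp add: sum_distrib_left[symmetric])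
qed

lemma link_energy_eq:
  "link_energy X m f u \<phi> \<xi> = (\<Sum>v\<in>nbrs u. m [u, v] * f (dist \<xi> (\<phi> v)))"
proof -
  have "{v. [v] \<in> ordered_simplices (cplx_link X {u}) 0} = nbrs u"
    by (auto simp: ordered_simplices_def cplx_link_def nbrs_def)
  then show ?thesis by (simp add: link_energy_def)
qed

lemma link_edge_energy_eq:
  assumes "u \<in> \<Union>X"
  shows "link_edge_energy X m f u \<phi> =
    (\<Sum>v\<in>nbrs u. \<Sum>w\<in>opposite u v. m [u, v, w] / 2 * f (dist (\<phi> v) (\<phi> w)))"
proof -
  have "{(v, w). [v, w] \<in> ordered_simplices (cplx_link X {u}) 1} = Sigma (nbrs u) (opposite u)"
    using opposite_nbrs(1)
    by (auto simp: ordered_simplices_def cplx_link_def opposite_def)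
  then show ?thesis
    using finite_nbrs[OF assms] finite_opposite[OF assms]
    by (simp add: link_edge_energy_def sum.Sigma)
qed

lemma link_term_nonneg: "gauge_fun f \<Longrightarrow> v \<in> nbrs u \<Longrightarrow> 0 \<le> m [u, v] * f (dist x y)"
  using weight_edge(1)[of v u] gauge_fun_nonneg[of f "dist x y"] by simp

lemma link_energy_nonneg: "gauge_fun f \<Longrightarrow> 0 \<le> link_energy X m f u \<phi> \<xi>"
  unfolding link_energy_eq by (intro sum_nonneg link_term_nonneg)

text \<open>
  The mixed energy of two maps: up to the weights, it compares \<open>\<psi>\<close> at one end of each edge with
  \<open>\<phi>\<close> at the other one. Summing over the representatives, normalised by the masses of their
  stabilisers, amounts to integrating over a fundamental domain.
\<close>

definition energy :: "(real \<Rightarrow> real) \<Rightarrow> ('v \<Rightarrow> 'z::metric_space) \<Rightarrow> ('v \<Rightarrow> 'z) \<Rightarrow> real" where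
  "energy f \<psi> \<phi> = (\<Sum>u\<in>R. link_energy X m f u \<phi> (\<psi> u) / stab_mass u)"

lemma energy_commute:
  fixes \<psi> \<phi> :: "'v \<Rightarrow> 'z::metric_space"
  assumes inv: "\<And>g u v. g \<in> carrier G \<Longrightarrow> u \<in> \<Union>X \<Longrightarrow> v \<in> \<Union>X \<Longrightarrow>
      dist (\<psi> (\<alpha> g u)) (\<phi> (\<alpha> g v)) = dist (\<psi> u) (\<phi> v)"
  shows "energy f \<psi> \<phi> = energy f \<phi> \<psi>"
proof -
  let ?F = "\<lambda>u v. m [u, v] * f (dist (\<psi> u) (\<phi> v))"
  have "energy f \<psi> \<phi> = (\<Sum>u\<in>R. (\<Sum>v\<in>nbrs u. ?F u v) / stab_mass u)"
    by (simp add: energy_def link_energy_eq)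
  also have "\<dots> = (\<Sum>u\<in>R. (\<Sum>v\<in>nbrs u. ?F v u) / stab_mass u)"
  proof (rule mass_transport)
    fix g u v assume "g \<in> carrier G" "u \<in> \<Union>X" "v \<in> nbrs u"
    then show "?F (\<alpha> g u) (\<alpha> g v) = ?F u v"
      using weight_edge(3)[of v u g] inv[of g u v] nbrs_vertex(2)[of v u] by simp
  qed (use finite_nbrs nbrs_vertex nbrs_sym act_nbrs in blast)+
  also have "\<dots> = energy f \<phi> \<psi>"
    unfolding energy_def link_energy_eq
    by (intro sum.cong refl arg_cong2[of _ _ _ _ "(/)"]) (simp add: weight_edge(2) dist_commute)
  finally show ?thesis .
qed

text \<open>
  Mass transport moves the contribution of a triangle \<open>u v w\<close> from \<open>u\<close>, in whose link the edge from
  \<open>v\<close> to \<open>w\<close> lies, to \<open>v\<close>. Collecting the triangles that contain this edge then produces the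
  constant \<open>C\<close>.
\<close>

lemma sum_link_edge_energy:
  fixes \<phi> :: "'v \<Rightarrow> 'z::metric_space"
  assumes inv: "\<And>g u v. g \<in> carrier G \<Longrightarrow> u \<in> \<Union>X \<Longrightarrow> v \<in> \<Union>X \<Longrightarrow>
      dist (\<phi> (\<alpha> g u)) (\<phi> (\<alpha> g v)) = dist (\<phi> u) (\<phi> v)"
  shows "(\<Sum>u\<in>R. link_edge_energy X m f u \<phi> / stab_mass u) = C / 2 * energy f \<phi> \<phi>"
proof -
  let ?e = "\<lambda>v w. f (dist (\<phi> v) (\<phi> w))"
  let ?F = "\<lambda>u v. \<Sum>w\<in>opposite u v. m [u, v, w] * ?e v w"
  have RX: "u \<in> \<Union>X" if "u \<in> R" for u using that reps_subset by blast
  have "(\<Sum>u\<in>R. link_edge_energy X m f u \<phi> / stab_mass u)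
      = (\<Sum>u\<in>R. (\<Sum>v\<in>nbrs u. ?F u v) / stab_mass u) / 2"
    unfolding sum_divide_distrib
    by (intro sum.cong refl) (simp add: link_edge_energy_eq[OF RX] sum_divide_distrib mult.commute)
  also have "(\<Sum>u\<in>R. (\<Sum>v\<in>nbrs u. ?F u v) / stab_mass u)
      = (\<Sum>u\<in>R. (\<Sum>v\<in>nbrs u. ?F v u) / stab_mass u)"
  proof (rule mass_transport)
    fix g u v assume g: "g \<in> carrier G" and v: "v \<in> nbrs u"
    have "inj_on (\<alpha> g) (opposite u v)"
      using act_eq_iff[OF g] nbrs_vertex(2) opposite_nbrs(2) by (meson inj_onI)
    then have "?F (\<alpha> g u) (\<alpha> g v) =
        (\<Sum>w\<in>opposite u v. m [\<alpha> g u, \<alpha> g v, \<alpha> g w] * ?e (\<alpha> g v) (\<alpha> g w))"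
      unfolding opposite_act[OF g v] by (simp add: sum.reindex)
    also have "\<dots> = ?F u v"
    proof (intro sum.cong refl arg_cong2[of _ _ _ _ "(*)"])
      fix w assume w: "w \<in> opposite u v"
      show "m [\<alpha> g u, \<alpha> g v, \<alpha> g w] = m [u, v, w]" by (rule weight_triangle(4)[OF w g])
      show "?e (\<alpha> g v) (\<alpha> g w) = ?e v w"
        using inv[OF g] nbrs_vertex(2)[OF v] nbrs_vertex(2)[OF opposite_nbrs(2)[OF w]] by simp
    qed
    finally show "?F (\<alpha> g u) (\<alpha> g v) = ?F u v" .
  qed (use finite_nbrs nbrs_vertex nbrs_sym act_nbrs in blast)+
  also have "\<dots> = (\<Sum>u\<in>R. C * link_energy X m f u \<phi> (\<phi> u) / stab_mass u)"
  proof (intro sum.cong refl arg_cong2[of _ _ _ _ "(/)"])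
    fix u assume "u \<in> R"
    note u = RX[OF this]
    have "(\<Sum>v\<in>nbrs u. ?F v u) = (\<Sum>v\<in>nbrs u. \<Sum>w\<in>opposite u v. m [u, v, w] * ?e u w)"
      using opposite_sym(2)[of _ u] weight_triangle(3)[of _ u] by (intro sum.cong) auto
    also have "\<dots> = (\<Sum>v\<in>nbrs u. \<Sum>w | w \<in> nbrs u \<and> w \<in> opposite u v. m [u, v, w] * ?e u w)"
      using opposite_nbrs(2) by (intro sum.cong refl) auto
    also have "\<dots> = (\<Sum>w\<in>nbrs u. \<Sum>v | v \<in> nbrs u \<and> w \<in> opposite u v. m [u, v, w] * ?e u w)"
      using finite_nbrs[OF u] by (rule sum.swap_restrict[rotated]) (rule finite_nbrs[OF u])
    also have "\<dots> = (\<Sum>w\<in>nbrs u. \<Sum>v\<in>opposite u w. m [u, w, v] * ?e u w)"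
      using opposite_nbrs(1) opposite_sym(1)[of _ u] weight_triangle(2)[of _ u]
      by (intro sum.cong refl) auto
    also have "\<dots> = C * link_energy X m f u \<phi> (\<phi> u)"
      unfolding link_energy_eq sum_distrib_left sum_distrib_right[symmetric]
      using weight_sum_opposite by (intro sum.cong refl) simp
    finally show "(\<Sum>v\<in>nbrs u. ?F v u) = C * link_energy X m f u \<phi> (\<phi> u)" .
  qed
  also have "\<dots> = C * energy f \<phi> \<phi>" by (simp add: energy_def sum_distrib_left)
  finally show ?thesis by simp
qed

end

section \<open>Decreasing the energy of equivariant maps\<close>

lemma summable_dist_convergent:
  fixes x :: "nat \<Rightarrow> 'z::complete_space"
  assumes a: "summable a" and d: "\<And>k. dist (x k) (x (Suc k)) \<le> a k"
  shows "convergent x"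
proof -
  have "Cauchy x"
  proof (rule metric_CauchyI)
    fix e :: real assume "e > 0"
    then obtain N where N: "\<And>m n. m \<ge> N \<Longrightarrow> norm (sum a {m..<n}) < e"
      using a unfolding summable_Cauchy by blast
    have tel: "dist (x m) (x n) \<le> sum a {m..<n}" if "m \<le> n" for m n
      using that
    proof (induction n rule: dec_induct)
      case (step n)
      have "dist (x m) (x (Suc n)) \<le> dist (x m) (x n) + dist (x n) (x (Suc n))"
        by (rule dist_triangle)
      with step d[of n] show ?case by simp
    qed simp
    have "dist (x m) (x n) < e" if "m \<ge> N" "n \<ge> N" for m n
    proof (cases "m \<le> n")
      case True
      then show ?thesis using tel[OF True] N[OF that(1), of n] by simp
    next
      case False
      then have "n \<le> m" by simp
      from tel[OF this] N[OF that(2), of m] show ?thesis by (simp add: dist_commute)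
    qed
    then show "\<exists>M. \<forall>m\<ge>M. \<forall>n\<ge>M. dist (x m) (x n) < e" by blast
  qed
  then show ?thesis by (rule Cauchy_convergent)
qed

locale equivariant_maps = weighted_complex X G \<alpha> T \<mu> R m C + midpoint_space mid
  for X :: "'v set set" and G :: "('g, 'e) monoid_scheme" (structure) and \<alpha> T \<mu> R m C
    and mid :: "'z::complete_space \<Rightarrow> 'z \<Rightarrow> 'z" +
  fixes f :: "real \<Rightarrow> real" and \<rho> :: "'g \<Rightarrow> 'z \<Rightarrow> 'z"
  assumes gauge: "gauge_fun f" and action: "isometric_action G T \<rho>"
begin

sublocale action_hom: group_hom G "isom_group :: ('z \<Rightarrow> 'z) monoid" \<rho>
  using action isom_group_group is_group
  by (simp add: group_hom_def group_hom_axioms_def isometric_action_def)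

lemma rho_isom: "g \<in> carrier G \<Longrightarrow> \<rho> g \<in> carrier isom_group"
  by (rule action_hom.hom_closed)

lemma rho_dist: "g \<in> carrier G \<Longrightarrow> dist (\<rho> g x) (\<rho> g y) = dist x y"
  using isom_groupD(2) rho_isom by blast

lemma rho_mult: "g \<in> carrier G \<Longrightarrow> h \<in> carrier G \<Longrightarrow> \<rho> (g \<otimes> h) x = \<rho> g (\<rho> h x)"
  using action_hom.hom_mult[of g h] by (simp add: isom_group_def)

definition equivariant :: "('v \<Rightarrow> 'z) \<Rightarrow> bool" where
  "equivariant \<phi> \<longleftrightarrow> (\<forall>g\<in>carrier G. \<forall>v\<in>\<Union>X. \<phi> (\<alpha> g v) = \<rho> g (\<phi> v))"

lemma equivariant_dist:
  assumes "equivariant \<phi>" "equivariant \<psi>" "g \<in> carrier G" "u \<in> \<Union>X" "v \<in> \<Union>X"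
  shows "dist (\<phi> (\<alpha> g u)) (\<psi> (\<alpha> g v)) = dist (\<phi> u) (\<psi> v)"
  using assms rho_dist unfolding equivariant_def by metis

lemma stabilizer_fixed_point:
  assumes u: "u \<in> \<Union>X" and S: "closed S" "S \<noteq> {}"
    and "\<And>x y. x \<in> S \<Longrightarrow> y \<in> S \<Longrightarrow> mid x y \<in> S"
    and inv: "\<And>g x. g \<in> transporter u u \<Longrightarrow> x \<in> S \<Longrightarrow> \<rho> g x \<in> S"
  shows "\<exists>p\<in>S. \<forall>g\<in>transporter u u. \<rho> g p = p"
proof -
  have "\<exists>p\<in>S. \<forall>h\<in>\<rho> ` transporter u u. h p = p"
  proof (rule compact_group_fixed_point)
    have "transporter u u = stabilizer G \<alpha> u" by (simp add: transporter_def stabilizer_def)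
    then show "subgroup (\<rho> ` transporter u u) isom_group"
      using action_hom.subgroup_img_is_subgroup stabilizer_subgroup[OF u] by simp
    fix x
    have "compactin euclidean ((\<lambda>g. \<rho> g x) ` transporter u u)"
      using action transporter_compact[OF u u] unfolding isometric_action_def transporter_def
      by (intro image_compactin[of T]) auto
    then show "compact ((\<lambda>h. h x) ` \<rho> ` transporter u u)" by (simp add: image_image)
  qed (use assms in auto)
  then show ?thesis by blast
qed

text \<open>
  Two group elements that carry the representative \<open>u\<close> to the same vertex differ by an element of
  the stabiliser of \<open>u\<close>, so the translate of \<open>p u\<close> does not depend on the choice between them.
\<close>

lemma equivariant_extension:
  assumes p: "\<And>u g. u \<in> R \<Longrightarrow> g \<in> transporter u u \<Longrightarrow> \<rho> g (p u) = p u"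
  obtains \<phi> where "equivariant \<phi>" "\<And>u. u \<in> R \<Longrightarrow> \<phi> u = p u"
proof -
  have "\<exists>u g. u \<in> R \<and> g \<in> carrier G \<and> \<alpha> g u = v" if "v \<in> \<Union>X" for v
    using reps_unique[OF that] unfolding orbit_def by blast
  then obtain rep \<gamma> where rep: "\<And>v. v \<in> \<Union>X \<Longrightarrow> rep v \<in> R"
      "\<And>v. v \<in> \<Union>X \<Longrightarrow> \<gamma> v \<in> carrier G" "\<And>v. v \<in> \<Union>X \<Longrightarrow> \<alpha> (\<gamma> v) (rep v) = v"
    by metis
  have unique: "rep v = u" if "u \<in> R" "g \<in> carrier G" "\<alpha> g u = v" "v \<in> \<Union>X" for u g v
  proof -
    have "v \<in> orbit G \<alpha> u" "v \<in> orbit G \<alpha> (rep v)"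
      using that rep[OF that(4)] unfolding orbit_def by force+
    then show ?thesis using reps_unique[OF that(4)] rep(1)[OF that(4)] that(1) by blast
  qed
  define \<phi> where "\<phi> v = \<rho> (\<gamma> v) (p (rep v))" for v
  have \<phi>: "\<phi> v = \<rho> g (p u)" if "u \<in> R" "g \<in> carrier G" "\<alpha> g u = v" for u g v
  proof -
    have uX: "u \<in> \<Union>X" using that(1) reps_subset by blast
    have v: "v \<in> \<Union>X" using act_closed[OF that(2) uX] that(3) by simp
    have r: "rep v = u" by (rule unique[OF that v])
    let ?h = "inv g \<otimes> \<gamma> v"
    have h: "?h \<in> transporter u u"
      using rep(2,3)[OF v] that uX act_inv[OF that(2) uX] unfolding r
      by (simp add: transporter_def composition_rule)
    have "\<gamma> v = g \<otimes> ?h" using rep(2)[OF v] that(2) by (simp add: m_assoc[symmetric])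
    then have "\<phi> v = \<rho> (g \<otimes> ?h) (p u)" by (simp add: \<phi>_def r)
    also have "\<dots> = \<rho> g (p u)"
      using p[OF that(1) h] rho_mult[of g ?h] that(2) h unfolding transporter_def by simp
    finally show ?thesis .
  qed
  have "equivariant \<phi>"
    unfolding equivariant_def
  proof (intro ballI)
    fix g v assume g: "g \<in> carrier G" and v: "v \<in> \<Union>X"
    have rX: "rep v \<in> \<Union>X" using rep(1)[OF v] reps_subset by blast
    have g\<gamma>: "\<alpha> (g \<otimes> \<gamma> v) (rep v) = \<alpha> g v" using rep(2,3)[OF v] g rX by (simp add: composition_rule)
    have "\<phi> (\<alpha> g v) = \<rho> (g \<otimes> \<gamma> v) (p (rep v))"
      by (rule \<phi>[OF rep(1)[OF v] m_closed[OF g rep(2)[OF v]] g\<gamma>])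
    then show "\<phi> (\<alpha> g v) = \<rho> g (\<phi> v)"
      by (simp only: rho_mult[OF g rep(2)[OF v]] \<phi>_def[of v])
  qed
  moreover have "\<phi> u = p u" if "u \<in> R" for u
  proof -
    have "u \<in> \<Union>X" using that reps_subset by blast
    then have "\<alpha> \<one> u = u" using id_eq_one by (metis restrict_apply')
    then have "\<phi> u = \<rho> \<one> (p u)" by (intro \<phi>[OF that]) auto
    then show ?thesis using action_hom.hom_one by (simp add: isom_group_def)
  qed
  ultimately show ?thesis using that by blast
qed

lemma equivariant_exists: "\<exists>\<phi>. equivariant \<phi>"
proof -
  have "\<exists>p. \<forall>g\<in>transporter u u. \<rho> g p = p" if "u \<in> R" for u
    using stabilizer_fixed_point[of u UNIV] that reps_subset by auto
  then obtain p where "\<And>u g. u \<in> R \<Longrightarrow> g \<in> transporter u u \<Longrightarrow> \<rho> g (p u) = p u" by metis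
  then show ?thesis using equivariant_extension by metis
qed

lemma dist_gauge_mid:
  "f (dist (mid a b) (mid c e)) \<le> (f (dist a c) + f (dist b e)) / 2"
  by (rule order_trans[OF gauge_fun_mono[OF gauge _ dist_mid_mid_le] gauge_fun_midpoint[OF gauge]]) auto

text \<open>
  The energy of the link at \<open>u\<close> is a convex function that is invariant under the stabiliser of
  \<open>u\<close>, so each of its sublevel sets contains a point that is fixed by the stabiliser. Such a
  point \<open>p\<close> can be the value of an equivariant map at \<open>u\<close>; the point \<open>c\<close> need not be fixed, even if
  it minimises the energy, because there may be several minimum points.
\<close>

lemma stabilizer_fixed_energy_le:
  assumes \<phi>: "equivariant \<phi>" and u: "u \<in> \<Union>X"
  shows "\<exists>p. (\<forall>g\<in>transporter u u. \<rho> g p = p) \<and> link_energy X m f u \<phi> p \<le> link_energy X m f u \<phi> c"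
proof -
  let ?E = "link_energy X m f u \<phi>"
  define S where "S = {x. ?E x \<le> ?E c}"
  have "\<exists>p\<in>S. \<forall>g\<in>transporter u u. \<rho> g p = p"
  proof (rule stabilizer_fixed_point[OF u])
    have "continuous_on UNIV (\<lambda>x. f \<bar>dist x (\<phi> v)\<bar>)" for v
      by (rule continuous_on_compose2[OF gauge_fun_continuous[OF gauge]]) (auto intro!: continuous_intros)
    then have "continuous_on UNIV ?E" unfolding link_energy_eq by (auto intro!: continuous_intros)
    then show "closed S" unfolding S_def by (intro closed_Collect_le continuous_on_const)
    show "S \<noteq> {}" by (auto simp: S_def)
    fix x y assume "x \<in> S" "y \<in> S"
    have "?E (mid x y) \<le> (\<Sum>v\<in>nbrs u. m [u, v] * ((f (dist x (\<phi> v)) + f (dist y (\<phi> v))) / 2))"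
      unfolding link_energy_eq
    proof (intro sum_mono mult_left_mono)
      fix v assume "v \<in> nbrs u"
      show "f (dist (mid x y) (\<phi> v)) \<le> (f (dist x (\<phi> v)) + f (dist y (\<phi> v))) / 2"
        using dist_gauge_mid[of x y "\<phi> v" "\<phi> v"] by (simp add: mid_idem)
      show "0 \<le> m [u, v]" using weight_edge(1)[OF \<open>v \<in> nbrs u\<close>] by simp
    qed
    also have "\<dots> = (?E x + ?E y) / 2"
      unfolding link_energy_eq
      by (simp add: sum.distrib[symmetric] sum_divide_distrib algebra_simps add_divide_distrib)
    also have "\<dots> \<le> ?E c" using \<open>x \<in> S\<close> \<open>y \<in> S\<close> by (simp add: S_def)
    finally show "mid x y \<in> S" by (simp add: S_def)
  next
    fix g x assume g: "g \<in> transporter u u" and x: "x \<in> S"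
    then have gG: "g \<in> carrier G" and gu: "\<alpha> g u = u" by (auto simp: transporter_def)
    have bij: "bij_betw (\<alpha> g) (nbrs u) (nbrs u)"
    proof (rule bij_betw_byWitness[where f' = "\<alpha> (inv g)"])
      have "\<alpha> (inv g) u = u" using act_inv[OF gG u] gu by simp
      then show "\<alpha> g ` nbrs u \<subseteq> nbrs u" "\<alpha> (inv g) ` nbrs u \<subseteq> nbrs u"
        using act_nbrs[OF gG, of _ u] act_nbrs[OF inv_closed[OF gG], of _ u] gu by auto
    qed (use act_inv[OF gG] act_inv'[OF gG] nbrs_vertex(2) in blast)+
    have "?E (\<rho> g x) = (\<Sum>v\<in>nbrs u. m [u, \<alpha> g v] * f (dist (\<rho> g x) (\<phi> (\<alpha> g v))))"
      unfolding link_energy_eq by (rule sum.reindex_bij_betw[OF bij, symmetric])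
    also have "\<dots> = ?E x"
      unfolding link_energy_eq
    proof (intro sum.cong refl arg_cong2[of _ _ _ _ "(*)"])
      fix v assume v: "v \<in> nbrs u"
      show "m [u, \<alpha> g v] = m [u, v]" using weight_edge(3)[OF v gG] gu by simp
      have "\<phi> (\<alpha> g v) = \<rho> g (\<phi> v)"
        using \<phi> gG nbrs_vertex(2)[OF v] unfolding equivariant_def by blast
      then show "f (dist (\<rho> g x) (\<phi> (\<alpha> g v))) = f (dist x (\<phi> v))" by (simp add: rho_dist[OF gG])
    qed
    finally show "\<rho> g x \<in> S" using x by (simp add: S_def)
  qed
  then show ?thesis by (auto simp: S_def)
qed

lemma energy_nonneg: "0 \<le> energy f \<psi> (\<phi> :: 'v \<Rightarrow> 'z)"
  unfolding energy_def
  by (intro sum_nonneg divide_nonneg_nonneg link_energy_nonneg[OF gauge] stab_mass_nonneg)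

text \<open>The energy, as a finite sum over edges modulo the group, controls every single edge.\<close>

lemma edge_le_energy:
  obtains L where "L > 0"
    "\<And>\<psi> \<phi> u v. equivariant \<psi> \<Longrightarrow> equivariant \<phi> \<Longrightarrow> v \<in> nbrs u \<Longrightarrow>
       f (dist (\<psi> u) (\<phi> v)) \<le> L * energy f \<psi> \<phi>"
proof -
  have RX: "u \<in> \<Union>X" if "u \<in> R" for u using that reps_subset by blast
  define L where "L = 1 + (\<Sum>u\<in>R. \<Sum>v\<in>nbrs u. stab_mass u / m [u, v])"
  have term_pos: "stab_mass u / m [u, v] > 0" if "u \<in> R" "v \<in> nbrs u" for u v
    using that stab_mass_pos RX weight_edge(1) by simp
  have L_term: "stab_mass u / m [u, v] \<le> L" if "u \<in> R" "v \<in> nbrs u" for u v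
  proof -
    have "stab_mass u / m [u, v] \<le> (\<Sum>v\<in>nbrs u. stab_mass u / m [u, v])"
      using that term_pos finite_nbrs RX by (intro member_le_sum) (auto intro: less_imp_le)
    also have "\<dots> \<le> (\<Sum>u\<in>R. \<Sum>v\<in>nbrs u. stab_mass u / m [u, v])"
      using that term_pos finite_reps
      by (intro member_le_sum[of u R "\<lambda>u. \<Sum>v\<in>nbrs u. stab_mass u / m [u, v]"] sum_nonneg)
        (auto intro: less_imp_le)
    finally show ?thesis by (simp add: L_def)
  qed
  have "L > 0" unfolding L_def using term_pos
    by (intro add_pos_nonneg sum_nonneg) (auto intro: less_imp_le)
  moreover have "f (dist (\<psi> u) (\<phi> v)) \<le> L * energy f \<psi> \<phi>"
    if eq: "equivariant \<psi>" "equivariant \<phi>" and v: "v \<in> nbrs u" for \<psi> \<phi> u v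
  proof -
    have uX: "u \<in> \<Union>X" by (rule nbrs_vertex(1)[OF v])
    obtain r g where r: "r \<in> R" and g: "g \<in> carrier G" "u = \<alpha> g r"
      using reps_unique[OF uX] unfolding orbit_def by blast
    define w where "w = \<alpha> (inv g) v"
    have w: "w \<in> nbrs r"
      using act_nbrs[OF inv_closed[OF g(1)] v] act_inv[OF g(1) RX[OF r]] by (simp add: w_def g(2))
    have v_eq: "v = \<alpha> g w" using act_inv'[OF g(1) nbrs_vertex(2)[OF v]] by (simp add: w_def)
    have s: "stab_mass r > 0" using stab_mass_pos RX[OF r] by blast
    have mw: "m [r, w] > 0" by (rule weight_edge(1)[OF w])
    let ?e = "f (dist (\<psi> r) (\<phi> w))"
    have "m [r, w] * ?e \<le> link_energy X m f r \<phi> (\<psi> r)"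
      unfolding link_energy_eq
      using w finite_nbrs[OF RX[OF r]] link_term_nonneg[OF gauge]
      by (intro member_le_sum[of w "nbrs r" "\<lambda>v. m [r, v] * f (dist (\<psi> r) (\<phi> v))"]) auto
    then have "m [r, w] * ?e / stab_mass r \<le> link_energy X m f r \<phi> (\<psi> r) / stab_mass r"
      using s by (intro divide_right_mono) auto
    also have "\<dots> \<le> energy f \<psi> \<phi>"
      unfolding energy_def using r finite_reps
      by (intro member_le_sum[of r R "\<lambda>u. link_energy X m f u \<phi> (\<psi> u) / stab_mass u"]
          divide_nonneg_nonneg link_energy_nonneg[OF gauge] stab_mass_nonneg)
    finally have "?e \<le> stab_mass r / m [r, w] * energy f \<psi> \<phi>"
      using s mw by (simp add: field_simps)
    also have "\<dots> \<le> L * energy f \<psi> \<phi>"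
      by (intro mult_right_mono L_term r w energy_nonneg)
    also have "?e = f (dist (\<psi> u) (\<phi> v))"
      using equivariant_dist[OF eq g(1) nbrs_vertex[OF w]] by (simp add: g(2) v_eq)
    finally show ?thesis .
  qed
  ultimately show ?thesis using that by blast
qed

text \<open>
  The averaging step. Choosing \<open>\<psi> u\<close> no worse than the centre of the link at \<open>u\<close>, the spectral gap
  bounds the mixed energy of \<open>\<psi>\<close> and \<open>\<phi>\<close> by \<open>C / (2 * l)\<close> times the energy of \<open>\<phi>\<close>. The energy of \<open>\<psi>\<close>
  itself is not under control, but that of the midpoint of \<open>\<phi>\<close> and \<open>\<psi>\<close> is: comparing \<open>\<phi> u\<close> with
  \<open>\<psi> v\<close> and \<open>\<psi> u\<close> with \<open>\<phi> v\<close> bounds it by the mean of the two mixed energies, which are equal.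
\<close>

lemma energy_decrease:
  assumes \<phi>: "equivariant \<phi>" and l: "l > 0"
    and gap: "\<And>u \<phi>::'v \<Rightarrow> 'z. u \<in> \<Union>X \<Longrightarrow>
      l * link_energy X m f u \<phi> (link_center X m f u \<phi>) \<le> link_edge_energy X m f u \<phi>"
  shows "\<exists>\<psi>. equivariant \<psi> \<and> energy f \<psi> \<phi> \<le> C / (2 * l) * energy f \<phi> \<phi> \<and>
    equivariant (\<lambda>u. mid (\<phi> u) (\<psi> u)) \<and>
    energy f (\<lambda>u. mid (\<phi> u) (\<psi> u)) (\<lambda>u. mid (\<phi> u) (\<psi> u)) \<le> C / (2 * l) * energy f \<phi> \<phi>"
proof -
  have RX: "u \<in> \<Union>X" if "u \<in> R" for u using that reps_subset by blast
  have "\<exists>p. (\<forall>g\<in>transporter u u. \<rho> g p = p) \<and>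
      link_energy X m f u \<phi> p \<le> link_energy X m f u \<phi> (link_center X m f u \<phi>)" if "u \<in> R" for u
    using stabilizer_fixed_energy_le[OF \<phi> RX[OF that]] .
  then obtain p where p: "\<And>u g. u \<in> R \<Longrightarrow> g \<in> transporter u u \<Longrightarrow> \<rho> g (p u) = p u"
    "\<And>u. u \<in> R \<Longrightarrow> link_energy X m f u \<phi> (p u) \<le> link_energy X m f u \<phi> (link_center X m f u \<phi>)"
    by metis
  obtain \<psi> where \<psi>: "equivariant \<psi>" "\<And>u. u \<in> R \<Longrightarrow> \<psi> u = p u"
    using equivariant_extension[of p] p(1) by metis
  let ?\<phi>' = "\<lambda>u. mid (\<phi> u) (\<psi> u)"
  have "l * energy f \<psi> \<phi> \<le> (\<Sum>u\<in>R. link_edge_energy X m f u \<phi> / stab_mass u)"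
    unfolding energy_def sum_distrib_left
  proof (intro sum_mono)
    fix u assume u: "u \<in> R"
    have "l * link_energy X m f u \<phi> (\<psi> u) \<le> link_edge_energy X m f u \<phi>"
      unfolding \<psi>(2)[OF u]
      by (rule order_trans[OF mult_left_mono[OF p(2)[OF u] less_imp_le[OF l]] gap[OF RX[OF u]]])
    then show "l * (link_energy X m f u \<phi> (\<psi> u) / stab_mass u) \<le> link_edge_energy X m f u \<phi> / stab_mass u"
      using stab_mass_pos[OF RX[OF u]] by (simp add: divide_right_mono)
  qed
  also have "\<dots> = C / 2 * energy f \<phi> \<phi>"
    by (rule sum_link_edge_energy) (rule equivariant_dist[OF \<phi> \<phi>])
  finally have mixed: "energy f \<psi> \<phi> \<le> C / (2 * l) * energy f \<phi> \<phi>"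
    using l by (simp add: field_simps)
  have comm: "energy f \<phi> \<psi> = energy f \<psi> \<phi>"
    by (rule energy_commute) (rule equivariant_dist[OF \<phi> \<psi>(1)])
  have "energy f ?\<phi>' ?\<phi>' \<le> (\<Sum>u\<in>R. (link_energy X m f u \<psi> (\<phi> u) + link_energy X m f u \<phi> (\<psi> u)) / 2 / stab_mass u)"
    unfolding energy_def
  proof (intro sum_mono divide_right_mono)
    fix u assume "u \<in> R"
    show "0 \<le> stab_mass u" using stab_mass_pos[OF RX[OF \<open>u \<in> R\<close>]] by simp
    have "link_energy X m f u ?\<phi>' (?\<phi>' u)
        \<le> (\<Sum>v\<in>nbrs u. m [u, v] * ((f (dist (\<phi> u) (\<psi> v)) + f (dist (\<psi> u) (\<phi> v))) / 2))"
      unfolding link_energy_eq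
    proof (intro sum_mono mult_left_mono)
      fix v assume v: "v \<in> nbrs u"
      show "f (dist (?\<phi>' u) (?\<phi>' v)) \<le> (f (dist (\<phi> u) (\<psi> v)) + f (dist (\<psi> u) (\<phi> v))) / 2"
        unfolding mid_commute[of "\<phi> v"] by (rule dist_gauge_mid)
      show "0 \<le> m [u, v]" using weight_edge(1)[OF v] by simp
    qed
    also have "\<dots> = (link_energy X m f u \<psi> (\<phi> u) + link_energy X m f u \<phi> (\<psi> u)) / 2"
      unfolding link_energy_eq
      by (simp add: sum.distrib[symmetric] sum_divide_distrib algebra_simps add_divide_distrib)
    finally show "link_energy X m f u ?\<phi>' (?\<phi>' u)
        \<le> (link_energy X m f u \<psi> (\<phi> u) + link_energy X m f u \<phi> (\<psi> u)) / 2" .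
  qed
  also have "\<dots> = (energy f \<phi> \<psi> + energy f \<psi> \<phi>) / 2"
    unfolding energy_def sum.distrib[symmetric] sum_divide_distrib by (simp add: add_divide_distrib mult.commute)
  finally have "energy f ?\<phi>' ?\<phi>' \<le> C / (2 * l) * energy f \<phi> \<phi>" using mixed comm by simp
  moreover have "equivariant ?\<phi>'"
    using \<phi> \<psi>(1) mid_isometry[OF rho_isom] unfolding equivariant_def by metis
  ultimately show ?thesis using \<psi>(1) mixed by (intro exI[of _ \<psi>] conjI)
qed

text \<open>
  Iterating the averaging step makes the energy decay geometrically, and the gauge function turns
  this into summable displacements. In the limit all edges have length zero, so the limit map is
  constant, and its value is fixed by the group because the map is equivariant.
\<close>

lemma fixed_point_of_spectral_gap:
  assumes conn: "cplx_connected X" and nb: "\<And>u. u \<in> \<Union>X \<Longrightarrow> nbrs u \<noteq> {}" and ne: "\<Union>X \<noteq> {}"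
    and C: "0 \<le> C" and l: "C / 2 < l"
    and gap: "\<And>u \<phi>::'v \<Rightarrow> 'z. u \<in> \<Union>X \<Longrightarrow>
      l * link_energy X m f u \<phi> (link_center X m f u \<phi>) \<le> link_edge_energy X m f u \<phi>"
  shows "\<exists>z. \<forall>g\<in>carrier G. \<rho> g z = z"
proof -
  define \<kappa> where "\<kappa> = C / (2 * l)"
  have l0: "l > 0" and \<kappa>: "0 \<le> \<kappa>" "\<kappa> < 1" using C l by (auto simp: \<kappa>_def divide_simps)
  obtain L where L: "L > 0"
    "\<And>\<psi> \<phi> u v. equivariant \<psi> \<Longrightarrow> equivariant \<phi> \<Longrightarrow> v \<in> nbrs u \<Longrightarrow>
       f (dist (\<psi> u) (\<phi> v)) \<le> L * energy f \<psi> \<phi>"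
    using edge_le_energy by blast
  let ?inv = "inv_into {0..} f"
  have step: "\<exists>\<phi>'. equivariant \<phi>' \<and> energy f \<phi>' \<phi>' \<le> \<kappa> * energy f \<phi> \<phi> \<and>
      (\<forall>u\<in>\<Union>X. \<forall>y\<ge>L * energy f \<phi> \<phi>. dist (\<phi> u) (\<phi>' u) \<le> ?inv y)" if \<phi>: "equivariant \<phi>" for \<phi>
  proof -
    from energy_decrease[OF \<phi> l0 gap] obtain \<psi> where \<psi>:
        "equivariant \<psi>" "energy f \<psi> \<phi> \<le> \<kappa> * energy f \<phi> \<phi>"
      and \<phi>': "equivariant (\<lambda>u. mid (\<phi> u) (\<psi> u))"
        "energy f (\<lambda>u. mid (\<phi> u) (\<psi> u)) (\<lambda>u. mid (\<phi> u) (\<psi> u)) \<le> \<kappa> * energy f \<phi> \<phi>"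
      unfolding \<kappa>_def by blast
    have "dist (\<phi> u) (mid (\<phi> u) (\<psi> u)) \<le> ?inv y" if u: "u \<in> \<Union>X" and y: "L * energy f \<phi> \<phi> \<le> y" for u y
    proof -
      obtain v where v: "v \<in> nbrs u" using nb[OF u] by blast
      have "f (dist (\<phi> u) (\<phi> v)) \<le> y" using L(2)[OF \<phi> \<phi> v] y by linarith
      then have 1: "dist (\<phi> u) (\<phi> v) \<le> ?inv y" by (intro gauge_fun_le_inv[OF gauge]) auto
      have "energy f \<psi> \<phi> \<le> energy f \<phi> \<phi>"
        using \<psi>(2) mult_left_le_one_le[OF energy_nonneg[of \<phi> \<phi>] \<kappa>(1)] \<kappa>(2) by linarith
      then have "L * energy f \<psi> \<phi> \<le> L * energy f \<phi> \<phi>" using L(1) by simp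
      then have "L * energy f \<psi> \<phi> \<le> y" using y by linarith
      then have "f (dist (\<psi> u) (\<phi> v)) \<le> y" using L(2)[OF \<psi>(1) \<phi> v] by linarith
      then have 2: "dist (\<psi> u) (\<phi> v) \<le> ?inv y" by (intro gauge_fun_le_inv[OF gauge]) auto
      have "dist (\<phi> u) (mid (\<phi> u) (\<psi> u)) \<le> dist (\<phi> u) (\<psi> u) / 2" by (rule dist_mid_left)
      also have "\<dots> \<le> (dist (\<phi> u) (\<phi> v) + dist (\<psi> u) (\<phi> v)) / 2"
        using dist_triangle2[of "\<phi> u" "\<psi> u" "\<phi> v"] by simp
      also have "\<dots> \<le> ?inv y" using 1 2 by simp
      finally show ?thesis .
    qed
    then show ?thesis using \<phi>' by (intro exI[of _ "\<lambda>u. mid (\<phi> u) (\<psi> u)"]) blast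
  qed
  have "\<exists>\<Phi>. \<forall>k. equivariant (\<Phi> k) \<and>
      (energy f (\<Phi> (Suc k)) (\<Phi> (Suc k)) \<le> \<kappa> * energy f (\<Phi> k) (\<Phi> k) \<and>
      (\<forall>u\<in>\<Union>X. \<forall>y\<ge>L * energy f (\<Phi> k) (\<Phi> k). dist (\<Phi> k u) (\<Phi> (Suc k) u) \<le> ?inv y))"
  proof (rule dependent_nat_choice)
    show "\<exists>\<phi>. equivariant \<phi>" by (rule equivariant_exists)
  qed (use step in blast)
  then obtain \<Phi> where \<Phi>: "\<forall>k. equivariant (\<Phi> k) \<and>
      (energy f (\<Phi> (Suc k)) (\<Phi> (Suc k)) \<le> \<kappa> * energy f (\<Phi> k) (\<Phi> k) \<and>
      (\<forall>u\<in>\<Union>X. \<forall>y\<ge>L * energy f (\<Phi> k) (\<Phi> k). dist (\<Phi> k u) (\<Phi> (Suc k) u) \<le> ?inv y))"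
    by (rule exE)
  have eq: "equivariant (\<Phi> k)"
    and dec: "energy f (\<Phi> (Suc k)) (\<Phi> (Suc k)) \<le> \<kappa> * energy f (\<Phi> k) (\<Phi> k)" for k
    using \<Phi> by blast+
  have move: "dist (\<Phi> k u) (\<Phi> (Suc k) u) \<le> ?inv y"
    if "u \<in> \<Union>X" "L * energy f (\<Phi> k) (\<Phi> k) \<le> y" for k u y
    using \<Phi> that by blast
  define K where "K = L * energy f (\<Phi> 0) (\<Phi> 0)"
  have K: "0 \<le> K" using L(1) energy_nonneg by (simp add: K_def)
  have decay: "L * energy f (\<Phi> k) (\<Phi> k) \<le> K * \<kappa> ^ k" for k
  proof (induction k)
    case (Suc k)
    have "L * energy f (\<Phi> (Suc k)) (\<Phi> (Suc k)) \<le> \<kappa> * (L * energy f (\<Phi> k) (\<Phi> k))"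
      using mult_left_mono[OF dec[of k], of L] L(1) by (simp add: mult.left_commute)
    also have "\<dots> \<le> \<kappa> * (K * \<kappa> ^ k)" by (intro mult_left_mono Suc \<kappa>)
    finally show ?case by (simp add: mult_ac)
  qed (simp add: K_def)
  define a where "a k = ?inv (K * \<kappa> ^ k)" for k
  have "summable (\<lambda>k. a (Suc k))"
    using gauge \<kappa> K unfolding gauge_fun_def a_def by blast
  then have a: "summable a" by (simp add: summable_Suc_iff)
  have "convergent (\<lambda>k. \<Phi> k u)" if "u \<in> \<Union>X" for u
    by (rule summable_dist_convergent[OF a]) (use move[OF that decay] in \<open>simp add: a_def\<close>)
  then obtain \<Psi> where \<Psi>: "\<And>u. u \<in> \<Union>X \<Longrightarrow> (\<lambda>k. \<Phi> k u) \<longlonglongrightarrow> \<Psi> u"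
    unfolding convergent_def by metis
  have edge: "\<Psi> u = \<Psi> v" if v: "v \<in> nbrs u" for u v
  proof -
    have "dist (\<Phi> k u) (\<Phi> k v) \<le> a k" for k
      unfolding a_def
      by (rule gauge_fun_le_inv[OF gauge zero_le_dist order_trans[OF L(2)[OF eq eq v] decay]])
    then have "\<forall>\<^sub>F k in sequentially. norm (dist (\<Phi> k u) (\<Phi> k v)) \<le> a k"
      by (intro always_eventually) simp
    then have "(\<lambda>k. dist (\<Phi> k u) (\<Phi> k v)) \<longlonglongrightarrow> 0"
      by (rule Lim_null_comparison[OF _ summable_LIMSEQ_zero[OF a]])
    moreover have "(\<lambda>k. dist (\<Phi> k u) (\<Phi> k v)) \<longlonglongrightarrow> dist (\<Psi> u) (\<Psi> v)"
      by (intro tendsto_dist \<Psi> nbrs_vertex[OF v])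
    ultimately have "0 = dist (\<Psi> u) (\<Psi> v)" by (rule LIMSEQ_unique)
    then show ?thesis by simp
  qed
  have const: "\<Psi> u = \<Psi> v" if "u \<in> \<Union>X" "v \<in> \<Union>X" for u v
  proof -
    have "(u, v) \<in> {(x, y). {x, y} \<in> X}\<^sup>*" using conn that unfolding cplx_connected_def by blast
    then show ?thesis
    proof induction
      case (step x y)
      then show ?case using edge[of y x] by (cases "x = y") (auto simp: nbrs_def)
    qed simp
  qed
  obtain u where u: "u \<in> \<Union>X" using ne by blast
  have "\<rho> g (\<Psi> u) = \<Psi> u" if g: "g \<in> carrier G" for g
  proof -
    have gu: "\<alpha> g u \<in> \<Union>X" by (rule act_closed[OF g u])
    have "(\<lambda>k. \<rho> g (\<Phi> k u)) \<longlonglongrightarrow> \<rho> g (\<Psi> u)"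
      by (rule continuous_on_tendsto_compose[OF isom_group_continuous[OF rho_isom[OF g], of UNIV] \<Psi>[OF u]])
        simp_all
    moreover have "\<Phi> k (\<alpha> g u) = \<rho> g (\<Phi> k u)" for k
      using eq[of k] g u unfolding equivariant_def by blast
    ultimately have "(\<lambda>k. \<Phi> k (\<alpha> g u)) \<longlonglongrightarrow> \<rho> g (\<Psi> u)" by simp
    then have "\<rho> g (\<Psi> u) = \<Psi> (\<alpha> g u)" using \<Psi>[OF gu] by (rule LIMSEQ_unique)
    then show ?thesis using const[OF gu u] by simp
  qed
  then show ?thesis by blast
qed

end

section \<open>The fixed point theorem\<close>

lemma (in group_action) finite_orbit_representatives:
  assumes W: "finite W" "W \<subseteq> E" and cover: "\<And>v. v \<in> E \<Longrightarrow> \<exists>w\<in>W. v \<in> orbit G \<phi> w"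
  shows "\<exists>R. finite R \<and> R \<subseteq> E \<and> (\<forall>v\<in>E. \<exists>!u. u \<in> R \<and> v \<in> orbit G \<phi> u)"
proof -
  have orbit_in: "z \<in> E" if "x \<in> E" "z \<in> orbit G \<phi> x" for x z
    using that element_image unfolding orbit_def by blast
  have orbit_eq: "orbit G \<phi> x = orbit G \<phi> y" if "x \<in> E" "y \<in> E" "y \<in> orbit G \<phi> x" for x y
  proof
    show "orbit G \<phi> x \<subseteq> orbit G \<phi> y"
    proof
      fix z assume z: "z \<in> orbit G \<phi> x"
      then have "z \<in> E" by (rule orbit_in[OF that(1)])
      then show "z \<in> orbit G \<phi> y" using orbit_trans[OF that(2,1)] orbit_sym[OF that] z by blast
    qed
    show "orbit G \<phi> y \<subseteq> orbit G \<phi> x"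
    proof
      fix z assume z: "z \<in> orbit G \<phi> y"
      then have "z \<in> E" by (rule orbit_in[OF that(2)])
      then show "z \<in> orbit G \<phi> x" using orbit_trans[OF that(1,2)] that(3) z by blast
    qed
  qed
  define c where "c A = (SOME u. u \<in> A)" for A :: "'c set"
  define R where "R = (\<lambda>w. c (orbit G \<phi> w)) ` W"
  have c: "c (orbit G \<phi> w) \<in> orbit G \<phi> w" if "w \<in> E" for w
    unfolding c_def using orbit_refl[OF that] by (rule someI)
  have cE: "c (orbit G \<phi> w) \<in> E" if "w \<in> E" for w
    by (rule orbit_in[OF that c[OF that]])
  have "\<exists>!u. u \<in> R \<and> v \<in> orbit G \<phi> u" if v: "v \<in> E" for v
  proof -
    obtain w where w: "w \<in> W" "v \<in> orbit G \<phi> w" using cover[OF v] by blast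
    have wE: "w \<in> E" using w(1) W(2) by blast
    show ?thesis
    proof (rule ex1I)
      show "c (orbit G \<phi> w) \<in> R \<and> v \<in> orbit G \<phi> (c (orbit G \<phi> w))"
        using w orbit_eq[OF wE cE[OF wE] c[OF wE]] by (simp add: R_def)
      fix u assume u: "u \<in> R \<and> v \<in> orbit G \<phi> u"
      then obtain x where x: "x \<in> W" "u = c (orbit G \<phi> x)" by (auto simp: R_def)
      have xE: "x \<in> E" using x(1) W(2) by blast
      have "orbit G \<phi> x = orbit G \<phi> u" using orbit_eq[OF xE cE[OF xE] c[OF xE]] by (simp add: x(2))
      also have "\<dots> = orbit G \<phi> v" using u cE[OF xE] v by (intro orbit_eq) (auto simp: x(2))
      also have "\<dots> = orbit G \<phi> w" using orbit_eq[OF wE v w(2)] by simp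
      finally show "u = c (orbit G \<phi> w)" by (simp add: x(2))
    qed
  qed
  moreover have "finite R" "R \<subseteq> E" using W cE by (auto simp: R_def)
  ultimately show ?thesis by (intro exI[of _ R]) simp
qed

lemma cplx_connected_neighbour:
  assumes "cplx_connected X" "u \<in> \<Union>X" "v \<in> \<Union>X" "v \<noteq> u"
  shows "\<exists>w. w \<noteq> u \<and> {u, w} \<in> X"
proof -
  have "(u, v) \<in> {(x, y). {x, y} \<in> X}\<^sup>*" using assms unfolding cplx_connected_def by blast
  then have "v = u \<or> (\<exists>w. w \<noteq> u \<and> {u, w} \<in> X)"
    by induction auto
  then show ?thesis using assms(4) by blast
qed

lemma fixed_point_in_midpoint_space:
  fixes X :: "'v set set" and G :: "('g, 'e) monoid_scheme" and T :: "'g topology"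
    and mid :: "'z::complete_space \<Rightarrow> 'z \<Rightarrow> 'z" and \<rho> :: "'g \<Rightarrow> 'z \<Rightarrow> 'z"
  assumes cplx: "simplicial_cplx X" and dim: "cplx_dim X n" "n \<ge> 2"
    and conn: "links_connected X" and fin: "vertex_links_finite X"
    and top: "topological_group G T" and unimod: "unimodular_group G T"
    and aut: "automorphism_group X G \<alpha>" and proper: "properly_discontinuous X G T \<alpha>"
    and cocompact: "cocompact_action X G \<alpha>" and weight: "weight X G \<alpha> m C" and gauge: "gauge_fun f"
    and mid: "midpoint_space mid" and gap: "min_link_lambda TYPE('z) X m f > ereal (C / 2)"
    and action: "isometric_action G T \<rho>"
  shows "\<exists>z. \<forall>\<gamma>\<in>carrier G. \<rho> \<gamma> z = z"
proof -
  interpret group_action G "\<Union>X" \<alpha>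
    by (rule faithful_action.axioms(1)[OF conjunct1[OF aut[unfolded automorphism_group_def]]])
  obtain F where F: "finite F" "F \<subseteq> X" "\<forall>\<sigma>\<in>X. \<exists>\<tau>\<in>F. \<exists>g\<in>carrier G. \<sigma> = \<alpha> g ` \<tau>"
    using cocompact unfolding cocompact_action_def by blast
  have cover: "\<exists>w\<in>\<Union>F. v \<in> orbit G \<alpha> w" if v: "v \<in> \<Union>X" for v
  proof -
    obtain \<sigma> where \<sigma>: "\<sigma> \<in> X" "v \<in> \<sigma>" using v by blast
    obtain \<tau> g where \<tau>: "\<tau> \<in> F" "g \<in> carrier G" "\<sigma> = \<alpha> g ` \<tau>"
      using bspec[OF F(3) \<sigma>(1)] by (elim bexE)
    obtain w where "w \<in> \<tau>" "v = \<alpha> g w" using \<sigma>(2) unfolding \<tau>(3) by (elim imageE)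
    then show ?thesis using \<tau>(1,2) unfolding orbit_def by (intro bexI[of _ w] UnionI[of \<tau>]) auto
  qed
  have "finite (\<Union>F)"
    using F(1,2) cplx unfolding simplicial_cplx_def by (intro finite_Union) auto
  moreover have "\<Union>F \<subseteq> \<Union>X" using F(2) by (rule Union_mono)
  ultimately have "\<exists>R. finite R \<and> R \<subseteq> \<Union>X \<and> (\<forall>v\<in>\<Union>X. \<exists>!u. u \<in> R \<and> v \<in> orbit G \<alpha> u)"
    by (rule finite_orbit_representatives[OF _ _ cover])
  then obtain R where R0: "finite R \<and> R \<subseteq> \<Union>X \<and> (\<forall>v\<in>\<Union>X. \<exists>!u. u \<in> R \<and> v \<in> orbit G \<alpha> u)" ..
  note R = conjunct1[OF R0] conjunct1[OF conjunct2[OF R0]] bspec[OF conjunct2[OF conjunct2[OF R0]]]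
  obtain \<mu> where haar: "left_haar_measure G T \<mu>"
    and right: "\<forall>g\<in>carrier G. \<forall>A\<in>sets \<mu>. emeasure \<mu> (A #>\<^bsub>G\<^esub> g) = emeasure \<mu> A"
    using unimod unfolding unimodular_group_def by blast
  interpret midpoint_space mid by (rule mid)
  interpret equivariant_maps X G \<alpha> T \<mu> R m C mid f \<rho>
  proof unfold_locales
    show "\<And>g A. g \<in> carrier G \<Longrightarrow> A \<in> sets \<mu> \<Longrightarrow> emeasure \<mu> (A #>\<^bsub>G\<^esub> g) = emeasure \<mu> A"
      using right by blast
    show "topspace T = carrier G" using top unfolding topological_group_def by blast
    show "\<And>u v. u \<in> \<Union>X \<Longrightarrow> v \<in> \<Union>X \<Longrightarrow> openin T {g \<in> carrier G. \<alpha> g u = v}"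
      "\<And>u v. u \<in> \<Union>X \<Longrightarrow> v \<in> \<Union>X \<Longrightarrow> compactin T {g \<in> carrier G. \<alpha> g u = v}"
      using proper unfolding properly_discontinuous_def by blast+
    show "\<And>g \<sigma>. g \<in> carrier G \<Longrightarrow> \<sigma> \<in> X \<Longrightarrow> \<alpha> g ` \<sigma> \<in> X"
      using aut unfolding automorphism_group_def by blast
  qed (fact haar R cplx fin weight gauge action)+
  obtain \<sigma> where \<sigma>: "\<sigma> \<in> X" "card \<sigma> = n + 1" using dim(1) unfolding cplx_dim_def by blast
  have "cplx_link X {} = X" using cplx unfolding cplx_link_def simplicial_cplx_def by auto
  then have X_conn: "cplx_connected X"
    using bspec[OF conn[unfolded links_connected_def], of "{}"] \<sigma> dim(2) by force
  have nb: "nbrs u \<noteq> {}" if u: "u \<in> \<Union>X" for u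
  proof -
    have "\<not> \<sigma> \<subseteq> {u}" using card_mono[of "{u}" \<sigma>] \<sigma>(2) dim(2) by auto
    then obtain v where "v \<in> \<Union>X" "v \<noteq> u" using \<sigma>(1) by blast
    then show ?thesis using cplx_connected_neighbour[OF X_conn u] by (auto simp: nbrs_def)
  qed
  have "\<sigma> \<noteq> {}" using \<sigma>(2) by auto
  then obtain u0 where u0: "u0 \<in> \<Union>X" using \<sigma>(1) by blast
  then obtain v0 where v0: "v0 \<in> nbrs u0" using nb by blast
  have "0 \<le> (\<Sum>w\<in>opposite u0 v0. m [u0, v0, w])"
    using weight_triangle(1) by (intro sum_nonneg) (auto intro: less_imp_le)
  then have C: "0 \<le> C"
    using weight_edge(1)[OF v0] by (simp add: weight_sum_opposite[OF v0] zero_le_mult_iff)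
  obtain l where l: "C / 2 < l" "ereal l < min_link_lambda TYPE('z) X m f"
    using ereal_dense2[OF gap] by auto
  show ?thesis
  proof (rule fixed_point_of_spectral_gap[OF X_conn nb _ C l(1)])
    show "\<Union>X \<noteq> {}" using u0 by blast
    fix u and \<phi> :: "'v \<Rightarrow> 'z" assume u: "u \<in> \<Union>X"
    have "ereal l < link_lambda TYPE('z) X m f u"
      using l(2) u unfolding min_link_lambda_def by (rule less_INF_D)
    then obtain l' where l': "l < l'" "\<And>\<phi>::'v \<Rightarrow> 'z.
        l' * link_energy X m f u \<phi> (link_center X m f u \<phi>) \<le> link_edge_energy X m f u \<phi>"
      unfolding link_lambda_def less_Sup_iff by auto
    have "l * link_energy X m f u \<phi> (link_center X m f u \<phi>)
        \<le> l' * link_energy X m f u \<phi> (link_center X m f u \<phi>)"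
      using l'(1) link_energy_nonneg[OF gauge] by (intro mult_right_mono) auto
    then show "l * link_energy X m f u \<phi> (link_center X m f u \<phi>) \<le> link_edge_energy X m f u \<phi>"
      using l'(2)[of \<phi>] by linarith
  qed
qed

theorem theorem3p4:
  fixes X :: "'v set set" and n :: nat
    and G :: "('g, 'e) monoid_scheme" and T :: "'g topology" and \<alpha> :: "'g \<Rightarrow> 'v \<Rightarrow> 'v"
    and m :: "'v list \<Rightarrow> real" and C :: real and f :: "real \<Rightarrow> real"
  assumes "simplicial_cplx X" and "cplx_dim X n" and "n \<ge> 2"
    and "links_connected X" and "vertex_links_finite X"
    and "topological_group G T" and "locally_compact_space T" and "unimodular_group G T"
    and "automorphism_group X G \<alpha>" and "properly_discontinuous X G T \<alpha>"
    and "cocompact_action X G \<alpha>"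
    and "weight X G \<alpha> m C"
    and "gauge_fun f"
  shows
    "(uniquely_geodesic TYPE('z::complete_space) \<and> metric_uniformly_convex TYPE('z) \<and>
      busemann_nonpos_curved TYPE('z) \<longrightarrow>
      min_link_lambda TYPE('z) X m f > ereal (C / 2) \<longrightarrow>
      (\<forall>\<rho>::'g \<Rightarrow> 'z \<Rightarrow> 'z. isometric_action G T \<rho> \<longrightarrow>
         (\<exists>z. \<forall>\<gamma>\<in>carrier G. \<rho> \<gamma> z = z))) \<and>
     (reflexive_space TYPE('b::banach) \<longrightarrow>
      min_link_lambda TYPE('b) X m f > ereal (C / 2) \<longrightarrow>
      (\<forall>\<rho>::'g \<Rightarrow> 'b \<Rightarrow> 'b. isometric_action G T \<rho> \<longrightarrow>
         (\<exists>z. \<forall>\<gamma>\<in>carrier G. \<rho> \<gamma> z = z)))"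
proof (intro conjI impI allI)
  fix \<rho> :: "'g \<Rightarrow> 'z \<Rightarrow> 'z"
  assume Z: "uniquely_geodesic TYPE('z) \<and> metric_uniformly_convex TYPE('z) \<and>
      busemann_nonpos_curved TYPE('z)"
    and "min_link_lambda TYPE('z) X m f > ereal (C / 2)" "isometric_action G T \<rho>"
  moreover have "midpoint_space (geodesic_midpoint :: 'z \<Rightarrow> 'z \<Rightarrow> 'z)"
    using Z busemann_midpoint_space by blast
  ultimately show "\<exists>z. \<forall>\<gamma>\<in>carrier G. \<rho> \<gamma> z = z"
    using fixed_point_in_midpoint_space[OF assms(1-6,8-13)] by blast
next
  fix \<rho> :: "'g \<Rightarrow> 'b \<Rightarrow> 'b"
  assume "min_link_lambda TYPE('b) X m f > ereal (C / 2)" "isometric_action G T \<rho>"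
  then show "\<exists>z. \<forall>\<gamma>\<in>carrier G. \<rho> \<gamma> z = z"
    using fixed_point_in_midpoint_space[OF assms(1-6,8-13) banach_midpoint_space] by blast
qed

end
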